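(* Let a tile have angles $(\alpha,\beta,2\pi/3)$ with non-commensurable angles, and suppose a triangle $ABC$ with angles $(2\alpha, \pi/3, 2\beta)$ is tiled by this tile. Then the tile has commensurable sides.
   Context: A tiling of $ABC$ is an expression of $ABC$ as a union of non-overlapping congruent copies of the tile. Non-commensurable angles means not all angles of the tile are rational multiples of $\pi$; commensurable sides means all pairwise ratios of the tile's side lengths are rational. *)

theory Defs
  imports "HOL-Analysis.Analysis"
begin

type_synonym plane = "real ^ 2"

(* The unoriented angle X Y Z at the vertex Y, in [0, pi]. *)
definition vertex_angle :: "plane \<Rightarrow> plane \<Rightarrow> plane \<Rightarrow> real" where
  "vertex_angle X Y Z =
     arccos (((X - Y) \<bullet> (Z - Y)) / (norm (X - Y) * norm (Z - Y)))"

(* Angles are listed in the order of the vertices. *)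
definition triangle_with_angles ::
  "plane \<Rightarrow> plane \<Rightarrow> plane \<Rightarrow> real \<Rightarrow> real \<Rightarrow> real \<Rightarrow> bool" where
  "triangle_with_angles A B C x y z \<longleftrightarrow>
     \<not> collinear {A, B, C} \<and>
     vertex_angle C A B = x \<and> vertex_angle A B C = y \<and> vertex_angle B C A = z"

definition triangle_region :: "plane \<Rightarrow> plane \<Rightarrow> plane \<Rightarrow> plane set" where
  "triangle_region A B C = convex hull {A, B, C}"

(* Congruence is by arbitrary isometries, so reflected copies are allowed. *)
definition congruent_copy :: "plane set \<Rightarrow> plane set \<Rightarrow> bool" where
  "congruent_copy S T \<longleftrightarrow>
     (\<exists>f. (\<forall>x y. dist (f x) (f y) = dist x y) \<and> T = f ` S)"

(* Tiles need not meet edge to edge.  For a tile with nonempty interior and a bounded region,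
   finiteness follows from the other conditions by comparing areas. *)
definition tiling_by :: "plane set set \<Rightarrow> plane set \<Rightarrow> plane set \<Rightarrow> bool" where
  "tiling_by \<T> tile region \<longleftrightarrow>
     finite \<T> \<and>
     (\<forall>T\<in>\<T>. congruent_copy tile T) \<and>
     pairwise (\<lambda>S T. interior S \<inter> interior T = {}) \<T> \<and>
     \<Union>\<T> = region"

definition commensurable_angles :: "real \<Rightarrow> real \<Rightarrow> real \<Rightarrow> bool" where
  "commensurable_angles x y z \<longleftrightarrow> (\<forall>t\<in>{x, y, z}. \<exists>q\<in>\<rat>. t = q * pi)"

definition commensurable_sides :: "plane \<Rightarrow> plane \<Rightarrow> plane \<Rightarrow> bool" where
  "commensurable_sides P Q R \<longleftrightarrow>
     (\<forall>s\<in>{dist Q R, dist R P, dist P Q}. \<forall>t\<in>{dist Q R, dist R P, dist P Q}. s / t \<in> \<rat>)"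

end

theory Submission
  imports Defs
begin

text \<open>
  Let \<open>a = |QR|\<close>, \<open>b = |RP|\<close>, \<open>c = |PQ|\<close>. Since \<open>\<alpha> / \<pi>\<close> is irrational, there is a function \<open>\<psi>\<close> on directions with values in \<open>{-1, 0, 1}\<close>
  that is invariant under rotation by \<open>\<alpha>\<close>, changes sign under rotation by \<open>\<pi> / 3\<close>, and does not
  vanish on one side of \<open>ABC\<close>. It is odd, so the sum of \<open>\<psi>(direction) * length\<close> over the sides of a
  positively oriented triangle is additive under tilings (a Hadwiger invariant). As \<open>\<alpha> + \<beta> = \<pi> / 3\<close>,
  every tile contributes an integer multiple of \<open>c + a - b\<close>, and the big triangle contributes
  \<open>\<plusminus> (|AB| + |BC| - |CA|)\<close>. Exchanging \<open>\<alpha>\<close> and \<open>\<beta>\<close>, this number is also an integer multiple of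
  \<open>c + b - a\<close>. Hence \<open>s = (a - b) / c\<close> and \<open>y = |CA| / c\<close> are rational. With \<open>t = (a + b) / c\<close>, the side
  \<open>|AB|\<close> equals \<open>c y (1 - s\<^sup>2 / 2 - t s / 2)\<close>, while it is also a sum of tile sides, in which \<open>t\<close> has a
  nonnegative coefficient. For \<open>s > 0\<close> the two expressions force \<open>t\<close> to be rational; for \<open>s < 0\<close> one
  uses \<open>|BC|\<close> instead, and \<open>s = 0\<close> would mean \<open>\<alpha> = \<pi> / 6\<close>.

  The additivity is read off areas: as a line sweeps across a triangle, the derivative of the area
  swept jumps exactly when the line passes a side parallel to it, by the length of that side.
\<close>

section \<open>Jumps in the derivative of the swept area\<close>

definition cut_area :: "plane set \<Rightarrow> plane \<Rightarrow> real \<Rightarrow> real" where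
  "cut_area K n t = measure lebesgue (K \<inter> {x. n \<bullet> x \<le> t})"

text \<open>The limit of this second difference quotient is the right derivative of the swept area at \<open>s\<close>
  minus the left one.\<close>
definition has_jump :: "plane set \<Rightarrow> plane \<Rightarrow> real \<Rightarrow> real \<Rightarrow> bool" where
  "has_jump K n s j \<longleftrightarrow>
     ((\<lambda>h. (cut_area K n (s + h) + cut_area K n (s - h) - 2 * cut_area K n s) / h) \<longlongrightarrow> j) (at_right 0)"

lemma has_jump_unique: "has_jump K n s i \<Longrightarrow> has_jump K n s j \<Longrightarrow> i = j"
  unfolding has_jump_def by (rule tendsto_unique[OF trivial_limit_at_right_real])

lemma compact_cut: "compact K \<Longrightarrow> compact (K \<inter> {x. n \<bullet> x \<le> t})"
  by (intro compact_Int_closed closed_halfspace_le)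

text \<open>Pieces with negligible overlaps have additive swept areas at every level, and the second
  difference quotient is linear in the area.\<close>

lemma has_jump_Union:
  assumes "finite \<F>" and "\<And>K. K \<in> \<F> \<Longrightarrow> compact K"
    and "pairwise (\<lambda>S T. negligible (S \<inter> T)) \<F>"
    and "\<And>K. K \<in> \<F> \<Longrightarrow> has_jump K n s (j K)"
  shows "has_jump (\<Union>\<F>) n s (\<Sum>K\<in>\<F>. j K)"
proof -
  have area: "cut_area (\<Union>\<F>) n t = (\<Sum>K\<in>\<F>. cut_area K n t)" for t
  proof -
    have "measure lebesgue (\<Union>((\<lambda>K. K \<inter> {x. n \<bullet> x \<le> t}) ` \<F>)) =
        (\<Sum>K\<in>\<F>. measure lebesgue (K \<inter> {x. n \<bullet> x \<le> t}))"
    proof (rule measure_negligible_finite_Union_image)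
      show "pairwise (\<lambda>x y. negligible (x \<inter> {x. n \<bullet> x \<le> t} \<inter> (y \<inter> {x. n \<bullet> x \<le> t}))) \<F>"
        using assms(3) by (rule pairwise_mono) (auto intro: negligible_subset)
    qed (use assms(1,2) in \<open>auto intro!: lmeasurable_compact compact_cut\<close>)
    moreover have "\<Union>((\<lambda>K. K \<inter> {x. n \<bullet> x \<le> t}) ` \<F>) = \<Union>\<F> \<inter> {x. n \<bullet> x \<le> t}"
      by auto
    ultimately show ?thesis
      by (simp add: cut_area_def)
  qed
  have "((\<lambda>h. \<Sum>K\<in>\<F>. (cut_area K n (s + h) + cut_area K n (s - h) - 2 * cut_area K n s) / h)
      \<longlongrightarrow> (\<Sum>K\<in>\<F>. j K)) (at_right 0)"
    using assms(4) unfolding has_jump_def by (intro tendsto_sum) auto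
  then show ?thesis
    unfolding has_jump_def area
    by (simp add: sum_divide_distrib sum_distrib_left sum.distrib sum_subtractf
        diff_divide_distrib add_divide_distrib)
qed

lemma has_jump_Un:
  assumes "compact K" "compact L" "negligible (K \<inter> L)" "has_jump K n s i" "has_jump L n s j"
  shows "has_jump (K \<union> L) n s (i + j)"
proof (cases "K = L")
  case False
  have "has_jump (\<Union>{K, L}) n s (\<Sum>M\<in>{K, L}. if M = K then i else j)"
    by (rule has_jump_Union) (use assms False in \<open>auto simp: pairwise_def Int_commute\<close>)
  with False show ?thesis by auto
next
  \<comment> \<open>Here \<open>{K, L}\<close> collapses to a singleton, so the sum over it would
    count only once. But \<open>K = L\<close> meets itself in a null set, so all swept areas and
    both jumps are zero.\<close>
  case True
  have 0: "cut_area K n t = 0" for t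
    unfolding cut_area_def
    by (rule negligible_imp_measure0) (use assms True in \<open>auto intro: negligible_subset\<close>)
  then have "has_jump K n s 0"
    by (simp add: has_jump_def)
  with assms True have "i = 0" "j = 0"
    by (auto dest: has_jump_unique)
  with True \<open>has_jump K n s 0\<close> show ?thesis
    by simp
qed

lemma cut_area_uminus:
  assumes "compact K" "n \<noteq> 0"
  shows "cut_area K (- n) (- t) = measure lebesgue K - cut_area K n t"
proof -
  have "measure lebesgue ((K \<inter> {x. n \<bullet> x \<le> t}) \<union> (K \<inter> {x. - n \<bullet> x \<le> - t})) =
      cut_area K n t + cut_area K (- n) (- t)"
  proof -
    have "negligible (K \<inter> {x. n \<bullet> x \<le> t} \<inter> (K \<inter> {x. - n \<bullet> x \<le> - t}))"
      by (rule negligible_subset[OF negligible_hyperplane[of n t]]) (use assms in auto)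
    then show ?thesis
      unfolding cut_area_def using assms(1)
      by (subst measure_Un3) (use compact_cut[of K "- n" "- t"] in
        \<open>auto intro!: lmeasurable_compact compact_cut simp: negligible_imp_measure0\<close>)
  qed
  moreover have "(K \<inter> {x. n \<bullet> x \<le> t}) \<union> (K \<inter> {x. - n \<bullet> x \<le> - t}) = K"
    by auto
  ultimately show ?thesis by simp
qed

text \<open>Sweeping in the opposite direction replaces the swept area by its complement in
  \<open>K\<close>, which negates second differences. This reduces a triangle with its apex below
  the base to one with its apex above.\<close>

lemma has_jump_uminus:
  assumes "compact K" "n \<noteq> 0" "has_jump K n s j"
  shows "has_jump K (- n) (- s) (- j)"
proof -
  have *: "cut_area K (-n) (- s + h) = measure lebesgue K - cut_area K n (s - h)"
    "cut_area K (-n) (- s - h) = measure lebesgue K - cut_area K n (s + h)" for h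
    using cut_area_uminus[OF assms(1,2), of "s - h"] cut_area_uminus[OF assms(1,2), of "s + h"]
    by simp_all
  from assms(3) have "((\<lambda>h. - ((cut_area K n (s + h) + cut_area K n (s - h) - 2 * cut_area K n s) / h))
      \<longlongrightarrow> - j) (at_right 0)"
    unfolding has_jump_def by (rule tendsto_minus)
  moreover have "- ((cut_area K n (s + h) + cut_area K n (s - h) - 2 * cut_area K n s) / h) =
      (cut_area K (- n) (- s + h) + cut_area K (- n) (- s - h) - 2 * cut_area K (- n) (- s)) / h" for h
    unfolding * cut_area_uminus[OF assms(1,2)] minus_divide_left
    by (rule arg_cong[where f = "\<lambda>x. x / h"]) simp
  ultimately show ?thesis
    unfolding has_jump_def by simp
qed

section \<open>Swept area of a triangle with one side on a level line\<close>

lemma compact_triangle: "compact (convex hull {U, V, W :: plane})"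
  by (intro compact_convex_hull finite_imp_compact) auto

lemma in_triangleI:
  fixes U V W :: "'a::real_vector"
  assumes "0 \<le> u" "0 \<le> v" "0 \<le> w" "u + v + w = 1"
  shows "u *\<^sub>R U + v *\<^sub>R V + w *\<^sub>R W \<in> convex hull {U, V, W}"
  unfolding convex_hull_3 using assms by blast

text \<open>The cut triangle is a homothetic image, so its area needs no integration.\<close>
lemma triangle_upper_part:
  fixes n U V W :: plane
  assumes U: "n \<bullet> U = p" and V: "n \<bullet> V = p" and W: "n \<bullet> W = q"
    and "p < q" "p \<le> t" "t \<le> q"
  defines "l \<equiv> (q - t) / (q - p)"
  shows "convex hull {U, V, W} \<inter> {x. n \<bullet> x \<ge> t} =
    (\<lambda>x. l *\<^sub>R x + (1 - l) *\<^sub>R W) ` (convex hull {U, V, W})"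
proof (intro equalityI subsetI)
  have l: "0 \<le> l" "l \<le> 1" "l * (q - p) = q - t"
    using assms by (auto simp: l_def divide_simps)
  fix x assume "x \<in> (\<lambda>x. l *\<^sub>R x + (1 - l) *\<^sub>R W) ` (convex hull {U, V, W})"
  then obtain u v w where uvw: "0 \<le> u" "0 \<le> v" "0 \<le> w" "u + v + w = 1"
    and x: "x = l *\<^sub>R (u *\<^sub>R U + v *\<^sub>R V + w *\<^sub>R W) + (1 - l) *\<^sub>R W"
    unfolding convex_hull_3 by auto
  have "x = (l * u) *\<^sub>R U + (l * v) *\<^sub>R V + (1 - l * u - l * v) *\<^sub>R W"
  proof -
    have w: "w = 1 - u - v" using uvw by simp
    show ?thesis unfolding x w by (simp add: algebra_simps scaleR_left_diff_distrib)
  qed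
  moreover have "l * u + l * v \<le> 1"
    using l uvw mult_left_le[of "u + v" l] by (simp add: distrib_left)
  ultimately have "x \<in> convex hull {U, V, W}"
    using l uvw by (auto intro!: in_triangleI)
  moreover have "n \<bullet> x = q - (q - t) * (u + v)"
  proof -
    have "n \<bullet> x = l * (u * p + v * p + w * q) + (1 - l) * q"
      unfolding x by (simp add: inner_add_right U V W)
    then show ?thesis using l(3) uvw(4) by algebra
  qed
  moreover have "(q - t) * (u + v) \<le> q - t"
    using uvw assms by (intro mult_left_le) auto
  ultimately show "x \<in> convex hull {U, V, W} \<inter> {x. n \<bullet> x \<ge> t}"
    by auto
next
  have l: "0 \<le> l" "l \<le> 1" "l * (q - p) = q - t"
    using assms by (auto simp: l_def divide_simps)
  fix x assume x: "x \<in> convex hull {U, V, W} \<inter> {x. n \<bullet> x \<ge> t}"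
  then obtain u v w where uvw: "0 \<le> u" "0 \<le> v" "0 \<le> w" "u + v + w = 1"
    and x': "x = u *\<^sub>R U + v *\<^sub>R V + w *\<^sub>R W"
    unfolding convex_hull_3 by auto
  have "t \<le> u * p + v * p + w * q"
    using x unfolding x' by (simp add: inner_add_right U V W)
  also have "\<dots> = q - (u + v) * (q - p)"
  proof -
    have w: "w = 1 - u - v" using uvw by simp
    show ?thesis unfolding w by (simp add: algebra_simps)
  qed
  finally have "(u + v) * (q - p) \<le> l * (q - p)"
    using l by simp
  then have le: "u + v \<le> l"
    using \<open>p < q\<close> mult_right_le_imp_le[of "u + v" "q - p" l] by linarith
  show "x \<in> (\<lambda>x. l *\<^sub>R x + (1 - l) *\<^sub>R W) ` (convex hull {U, V, W})"
  \<comment> \<open>For \<open>l = 0\<close> the homothety collapses everything to its centre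
    \<open>W\<close>; otherwise it can be inverted, and \<open>y\<close> below is the preimage of
    \<open>x\<close>.\<close>
  proof (cases "l = 0")
    case True
    with le uvw have "u = 0" "v = 0" "w = 1" by auto
    then have "x = W" using x' by simp
    moreover have "W \<in> convex hull {U, V, W}" by (simp add: hull_inc)
    ultimately show ?thesis using True by force
  next
    case False
    with l have l0: "l > 0" by simp
    define y where "y = (u / l) *\<^sub>R U + (v / l) *\<^sub>R V + (1 - u / l - v / l) *\<^sub>R W"
    have "u / l + v / l \<le> 1"
      using le l0 by (simp add: divide_simps)
    then have "y \<in> convex hull {U, V, W}"
      unfolding y_def using uvw l0 by (auto intro!: in_triangleI)
    moreover have "x = l *\<^sub>R y + (1 - l) *\<^sub>R W"
    proof -
      have w: "w = 1 - u - v" using uvw by simp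
      have *: "l * (1 - u / l - v / l) = l - u - v"
        using l0 by (simp add: field_simps)
      have "l *\<^sub>R y = u *\<^sub>R U + v *\<^sub>R V + (l - u - v) *\<^sub>R W"
        unfolding y_def scaleR_add_right scaleR_scaleR * using l0 by simp
      then show ?thesis
        unfolding x' w by (simp add: algebra_simps)
    qed
    ultimately show ?thesis by blast
  qed
qed

lemma inner_2: "(u :: plane) \<bullet> v = u $ 1 * v $ 1 + u $ 2 * v $ 2"
  by (simp add: inner_vec_def sum_2)

lemma norm_2_square: "(norm (u :: plane))\<^sup>2 = (u $ 1)\<^sup>2 + (u $ 2)\<^sup>2"
  unfolding power2_norm_eq_inner by (simp add: inner_2 power2_eq_square)

lemma area_horizontal_triangle:
  fixes n U V W :: plane
  assumes n: "norm n = 1" and U: "n \<bullet> U = p" and V: "n \<bullet> V = p" and W: "n \<bullet> W = q" and "p \<le> q"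
  shows "measure lebesgue (convex hull {U, V, W}) = dist U V * (q - p) / 2"
proof -
  let ?d = "(W $ 1 - U $ 1) * (V $ 2 - U $ 2) - (V $ 1 - U $ 1) * (W $ 2 - U $ 2)"
  have "convex hull {U, V, W} \<in> sets borel"
    using compact_triangle by (intro borel_compact)
  then have "measure lebesgue (convex hull {U, V, W}) = \<bar>?d\<bar> / 2"
    using content_triangle[of U V W] by (simp add: measure_completion)
  moreover have "\<bar>?d\<bar> = dist U V * (q - p)"
  proof (rule power2_eq_imp_eq)
    define e1 e2 w1 w2 where "e1 = V $ 1 - U $ 1" "e2 = V $ 2 - U $ 2"
      "w1 = W $ 1 - U $ 1" "w2 = W $ 2 - U $ 2"
    note defs = this
    have n1: "n $ 1 * n $ 1 + n $ 2 * n $ 2 = 1"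
      using n norm_2_square[of n] by (simp add: power2_eq_square)
    have e: "n $ 1 * e1 + n $ 2 * e2 = 0"
      using U V by (simp add: defs inner_2 algebra_simps)
    have w: "q - p = n $ 1 * w1 + n $ 2 * w2"
      using U W by (simp add: defs inner_2 algebra_simps)
    have d: "(dist U V)\<^sup>2 = e1\<^sup>2 + e2\<^sup>2"
      unfolding dist_commute[of U V] dist_norm norm_2_square by (simp add: defs power2_commute)
    \<comment> \<open>The unit vector \<open>n\<close> is orthogonal to the base \<open>e\<close>,
      so up to sign the determinant of \<open>e\<close> and \<open>w\<close> is the length of
      \<open>e\<close> times the component of \<open>w\<close> along \<open>n\<close>. Squaring
      removes the sign.\<close>
    have "(w1 * e2 - e1 * w2)\<^sup>2 = (e1\<^sup>2 + e2\<^sup>2) * (n $ 1 * w1 + n $ 2 * w2)\<^sup>2"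
      using n1 e by algebra
    then show "\<bar>?d\<bar>\<^sup>2 = (dist U V * (q - p))\<^sup>2"
      unfolding power2_abs power_mult_distrib d w by (simp add: defs)
  qed (use assms in auto)
  ultimately show ?thesis by simp
qed

lemma inner_le_on_hull:
  assumes "\<And>x. x \<in> S \<Longrightarrow> n \<bullet> x \<le> t" "y \<in> convex hull S"
  shows "n \<bullet> y \<le> t"
proof -
  have "convex hull S \<subseteq> {x. n \<bullet> x \<le> t}"
    by (rule hull_minimal) (use assms in \<open>auto intro: convex_halfspace_le\<close>)
  with assms show ?thesis by auto
qed

lemma inner_ge_on_hull:
  assumes "\<And>x. x \<in> S \<Longrightarrow> n \<bullet> x \<ge> t" "y \<in> convex hull S"
  shows "n \<bullet> y \<ge> t"
  using inner_le_on_hull[of S "-n" "-t" y] assms by simp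

text \<open>The part above level \<open>t\<close> is the triangle shrunk towards \<open>W\<close> by
  the factor \<open>(q - t) / (q - p)\<close>, so its area scales by the square of that
  factor.\<close>

lemma cut_area_horizontal_triangle:
  fixes n U V W :: plane
  assumes n: "norm n = 1" and U: "n \<bullet> U = p" and V: "n \<bullet> V = p" and W: "n \<bullet> W = q" and "p < q"
  defines "A \<equiv> measure lebesgue (convex hull {U, V, W})"
  shows "t \<le> p \<Longrightarrow> cut_area (convex hull {U, V, W}) n t = 0"
    and "p \<le> t \<Longrightarrow> t \<le> q \<Longrightarrow> cut_area (convex hull {U, V, W}) n t = A * (1 - ((q - t) / (q - p))\<^sup>2)"
    and "q \<le> t \<Longrightarrow> cut_area (convex hull {U, V, W}) n t = A"
proof -
  let ?K = "convex hull {U, V, W}"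
  have n0: "n \<noteq> 0" using n by auto
  have lo: "p \<le> n \<bullet> x" and hi: "n \<bullet> x \<le> q" if "x \<in> ?K" for x
  proof -
    show "p \<le> n \<bullet> x"
      by (rule inner_ge_on_hull[OF _ that]) (use U V W \<open>p < q\<close> in auto)
    show "n \<bullet> x \<le> q"
      by (rule inner_le_on_hull[OF _ that]) (use U V W \<open>p < q\<close> in auto)
  qed
  show "cut_area ?K n t = 0" if "t \<le> p"
  proof -
    have "?K \<inter> {x. n \<bullet> x \<le> t} \<subseteq> {x. n \<bullet> x = p}"
      using lo that by force
    then have "negligible (?K \<inter> {x. n \<bullet> x \<le> t})"
      using n0 by (intro negligible_subset[OF negligible_hyperplane[of n p]]) simp_all
    then show ?thesis
      unfolding cut_area_def by (rule negligible_imp_measure0)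
  qed
  show "cut_area ?K n t = A" if "q \<le> t"
  proof -
    have "?K \<inter> {x. n \<bullet> x \<le> t} = ?K"
      using hi that by force
    then show ?thesis by (simp add: cut_area_def A_def)
  qed
  show "cut_area ?K n t = A * (1 - ((q - t) / (q - p))\<^sup>2)" if "p \<le> t" "t \<le> q"
  proof -
    define l where "l = (q - t) / (q - p)"
    have "cut_area ?K (- n) (- t) = measure lebesgue (?K \<inter> {x. n \<bullet> x \<ge> t})"
      by (simp add: cut_area_def)
    also have "?K \<inter> {x. n \<bullet> x \<ge> t} = (\<lambda>x. l *\<^sub>R x + (1 - l) *\<^sub>R W) ` ?K"
      unfolding l_def by (rule triangle_upper_part[OF U V W \<open>p < q\<close> that])
    also have "(\<lambda>x. l *\<^sub>R x + (1 - l) *\<^sub>R W) = (\<lambda>x. (1 - l) *\<^sub>R W + l *\<^sub>R x)"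
      by (simp add: add.commute)
    also have "measure lebesgue (\<dots> ` ?K) = \<bar>l\<bar> ^ 2 * A"
      using measure_lebesgue_affine[of l "(1 - l) *\<^sub>R W" ?K]
      by (simp add: A_def image_image add.commute power2_eq_square)
    finally have "A - cut_area ?K n t = l\<^sup>2 * A"
      using cut_area_uminus[OF compact_triangle n0, of U V W t] by (simp add: A_def)
    then show ?thesis
      by (simp add: l_def[symmetric] algebra_simps)
  qed
qed

text \<open>The swept area of a triangle is piecewise quadratic in the level, so near
  \<open>s\<close> its second difference is exactly a linear term, the jump, plus a quadratic one
  with coefficient \<open>e\<close>.\<close>

lemma has_jumpI:
  assumes "\<delta> > 0"
    and "\<And>h. 0 < h \<Longrightarrow> h < \<delta> \<Longrightarrow>
      cut_area K n (s + h) + cut_area K n (s - h) - 2 * cut_area K n s = (j + e * h) * h"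
  shows "has_jump K n s j"
proof -
  have "((\<lambda>h. j + e * h) \<longlongrightarrow> j + e * 0) (at_right 0)"
    by (intro tendsto_intros)
  moreover have "\<forall>\<^sub>F h in at_right 0. j + e * h =
      (cut_area K n (s + h) + cut_area K n (s - h) - 2 * cut_area K n s) / h"
    unfolding eventually_at_right_field using assms by (intro exI[of _ \<delta>]) auto
  ultimately show ?thesis
    unfolding has_jump_def by (simp add: tendsto_cong)
qed

lemma has_jump_horizontal_triangle_less:
  fixes n U V W :: plane
  assumes n: "norm n = 1" and U: "n \<bullet> U = p" and V: "n \<bullet> V = p" and W: "n \<bullet> W = q" and "p < q"
  shows "has_jump (convex hull {U, V, W}) n s (if s = p then dist U V else 0)"
proof -
  let ?K = "convex hull {U, V, W}"
  define A where "A = measure lebesgue ?K"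
  define d where "d = q - p"
  have d: "d > 0" "q = p + d" using \<open>p < q\<close> by (auto simp: d_def)
  have A: "A = dist U V * d / 2"
    unfolding A_def d_def by (rule area_horizontal_triangle) (use assms in auto)
  note C = cut_area_horizontal_triangle[OF n U V W \<open>p < q\<close>, folded A_def, folded d_def]
  consider "s < p" | "s = p" | "p < s" "s < q" | "s = q" | "q < s"
    by linarith
  then show ?thesis
  proof cases
    case 1
    then show ?thesis
      by (intro has_jumpI[of "p - s" _ _ _ _ 0]) (auto simp: C)
  next
    \<comment> \<open>At the base level the area starts to grow at rate \<open>2 * A / d\<close>,
      which is the base length. At the apex level, in case 4, the remaining area vanishes
      quadratically, so there is no jump.\<close>
    case 2
    have "A * (1 - ((q - (p + h)) / d)\<^sup>2) = (dist U V + - A / d\<^sup>2 * h) * h" for h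
      using d by (simp add: A field_simps power2_eq_square)
    with 2 d show ?thesis
      by (intro has_jumpI[of d _ _ _ _ "- A / d\<^sup>2"]) (auto simp: C)
  next
    case 3
    have "A * (1 - ((q - (s + h)) / d)\<^sup>2) + A * (1 - ((q - (s - h)) / d)\<^sup>2)
        - 2 * (A * (1 - ((q - s) / d)\<^sup>2)) = (0 + - 2 * A / d\<^sup>2 * h) * h" for h
      using d by (simp add: field_simps power2_eq_square)
    with 3 show ?thesis
      by (intro has_jumpI[of "min (s - p) (q - s)" _ _ _ _ "- 2 * A / d\<^sup>2"]) (auto simp: C)
  next
    case 4
    have "A + A * (1 - (h / d)\<^sup>2) - 2 * A = (0 + - A / d\<^sup>2 * h) * h" for h
      using d by (simp add: field_simps power2_eq_square)
    with 4 d show ?thesis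
      by (intro has_jumpI[of d _ _ _ _ "- A / d\<^sup>2"]) (auto simp: C)
  next
    case 5
    with \<open>p < q\<close> show ?thesis
      by (intro has_jumpI[of "s - q" _ _ _ _ 0]) (auto simp: C)
  qed
qed

lemma has_jump_horizontal_triangle:
  fixes n U V W :: plane
  assumes n: "norm n = 1" and U: "n \<bullet> U = p" and V: "n \<bullet> V = p" and W: "n \<bullet> W = q"
  shows "has_jump (convex hull {U, V, W}) n s (if s = p then dist U V * sgn (q - p) else 0)"
proof -
  have n0: "n \<noteq> 0" using n by auto
  consider "p < q" | "q < p" | "p = q" by linarith
  then show ?thesis
  proof cases
    case 1
    with has_jump_horizontal_triangle_less[OF n U V W 1, of s] show ?thesis
      by (simp split: if_splits)
  next
    case 2
    have "has_jump (convex hull {U, V, W}) (- n) (- s) (if - s = - p then dist U V else 0)"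
      by (rule has_jump_horizontal_triangle_less[where q = "- q"]) (use assms 2 in auto)
    from has_jump_uminus[OF compact_triangle _ this] n0 2 show ?thesis
      by (simp split: if_splits)
  next
    \<comment> \<open>Degenerate triangle inside one level line: it has area zero, in accordance
      with \<open>sgn 0 = 0\<close>.\<close>
    case 3
    have "x \<in> convex hull {U, V, W} \<Longrightarrow> n \<bullet> x = p" for x
      using inner_le_on_hull[of "{U, V, W}" n p x] inner_ge_on_hull[of "{U, V, W}" p n x] assms 3
      by force
    then have "convex hull {U, V, W} \<inter> {x. n \<bullet> x \<le> t} \<subseteq> {x. n \<bullet> x = p}" for t
      by blast
    then have "cut_area (convex hull {U, V, W}) n t = 0" for t
      unfolding cut_area_def
      by (intro negligible_imp_measure0 negligible_subset[OF negligible_hyperplane[of n p]])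
        (use n0 in auto)
    with 3 show ?thesis by (simp add: has_jump_def)
  qed
qed

section \<open>The jump of an arbitrary triangle\<close>

lemma triangle_split:
  fixes U V W :: "'a::real_vector"
  assumes "0 < r" "r < 1" and M: "M = (1 - r) *\<^sub>R U + r *\<^sub>R W"
  shows "convex hull {U, V, W} = convex hull {V, M, U} \<union> convex hull {V, M, W}"
proof (intro equalityI subsetI)
  fix x assume "x \<in> convex hull {U, V, W}"
  then obtain u v w where uvw: "0 \<le> u" "0 \<le> v" "0 \<le> w" "u + v + w = 1"
    and x: "x = u *\<^sub>R U + v *\<^sub>R V + w *\<^sub>R W"
    unfolding convex_hull_3 by auto
  \<comment> \<open>The sign of \<open>(1 - r) * w - r * u\<close> tells on which side of the line
    \<open>V M\<close> the point lies. On the side of \<open>U\<close> the whole weight of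
    \<open>W\<close> is absorbed into \<open>M\<close>, which fixes the coefficient
    \<open>a = w / r\<close>; the other side is symmetric.\<close>
  show "x \<in> convex hull {V, M, U} \<union> convex hull {V, M, W}"
  proof (cases "(1 - r) * w \<le> r * u")
    case True
    define a where "a = w / r"
    have w: "w = r * a" using assms by (simp add: a_def)
    have "r * ((1 - r) * a) \<le> r * u"
      using True by (simp add: w mult.left_commute)
    then have "(1 - r) * a \<le> u"
      using assms by (simp add: mult_le_cancel_left)
    moreover have "0 \<le> a" using uvw assms by (simp add: a_def)
    moreover have "v + a + (u - (1 - r) * a) = 1"
      using uvw(4) by (simp add: w algebra_simps)
    moreover have "x = v *\<^sub>R V + a *\<^sub>R M + (u - (1 - r) * a) *\<^sub>R U"
      by (simp add: x w M algebra_simps)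
    ultimately show ?thesis
      using in_triangleI[of v a "u - (1 - r) * a" V M U] uvw by simp
  next
    case False
    define a where "a = u / (1 - r)"
    have u: "u = (1 - r) * a" using assms by (simp add: a_def)
    have "(1 - r) * (r * a) \<le> (1 - r) * w"
      using False by (simp add: u mult.left_commute)
    then have "r * a \<le> w"
      using assms by (simp add: mult_le_cancel_left)
    moreover have "0 \<le> a" using uvw assms by (simp add: a_def)
    moreover have "v + a + (w - r * a) = 1"
      using uvw(4) by (simp add: u algebra_simps)
    moreover have "x = v *\<^sub>R V + a *\<^sub>R M + (w - r * a) *\<^sub>R W"
      by (simp add: x u M algebra_simps)
    ultimately show ?thesis
      using in_triangleI[of v a "w - r * a" V M W] uvw by simp
  qed
next
  have "(1 - r) *\<^sub>R U + 0 *\<^sub>R V + r *\<^sub>R W \<in> convex hull {U, V, W}"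
    using assms by (intro in_triangleI) auto
  then have M': "M \<in> convex hull {U, V, W}"
    by (simp add: M)
  have "{U, V, W} \<subseteq> convex hull {U, V, W}" by (rule hull_subset)
  with M' have "{V, M, U} \<subseteq> convex hull {U, V, W}" "{V, M, W} \<subseteq> convex hull {U, V, W}"
    by blast+
  then have "convex hull {V, M, U} \<subseteq> convex hull {U, V, W}"
    "convex hull {V, M, W} \<subseteq> convex hull {U, V, W}"
    by (simp_all only: hull_minimal convex_convex_hull)
  then show "x \<in> convex hull {U, V, W}" if "x \<in> convex hull {V, M, U} \<union> convex hull {V, M, W}" for x
    using that by blast
qed

text \<open>The level line through the middle vertex \<open>V\<close> meets the opposite side in
  \<open>M\<close> and cuts the triangle into two with common base \<open>V M\<close>. Their apexes
  lie on opposite sides of that base, so the two jumps cancel.\<close>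

lemma has_jump_sorted_triangle:
  fixes n U V W :: plane
  assumes n: "norm n = 1" and "n \<bullet> U < n \<bullet> V" "n \<bullet> V < n \<bullet> W"
  shows "has_jump (convex hull {U, V, W}) n s 0"
proof -
  define p q m where "p = n \<bullet> U" and "q = n \<bullet> W" and "m = n \<bullet> V"
  note defs = this
  have less: "p < m" "m < q" using assms by (auto simp: defs)
  define r where "r = (m - p) / (q - p)"
  define M where "M = (1 - r) *\<^sub>R U + r *\<^sub>R W"
  have r: "0 < r" "r < 1" "r * (q - p) = m - p" using less by (auto simp: r_def)
  have "n \<bullet> M = p + r * (q - p)"
    by (simp add: M_def inner_add_right defs algebra_simps)
  then have M: "n \<bullet> M = m" using r by simp
  let ?K = "convex hull {V, M, U}" and ?L = "convex hull {V, M, W}"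
  have "has_jump (?K \<union> ?L) n s ((if s = m then dist V M * sgn (p - m) else 0)
      + (if s = m then dist V M * sgn (q - m) else 0))"
  proof (intro has_jump_Un compact_triangle has_jump_horizontal_triangle n M)
    have "x \<in> ?K \<Longrightarrow> n \<bullet> x \<le> m" "x \<in> ?L \<Longrightarrow> n \<bullet> x \<ge> m" for x
      by (rule inner_le_on_hull[of "{V, M, U}"] inner_ge_on_hull[of "{V, M, W}"];
        use less M in \<open>auto simp: defs\<close>)+
    then have "?K \<inter> ?L \<subseteq> {x. n \<bullet> x = m}"
      by (auto intro: antisym)
    moreover have "n \<noteq> 0" using n by auto
    ultimately show "negligible (?K \<inter> ?L)"
      using negligible_subset[OF negligible_hyperplane[of n m]] by blast
  qed (auto simp: defs)
  then show ?thesis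
    using less triangle_split[OF r(1,2) M_def, of V] by (auto split: if_splits)
qed

text \<open>The sign is positive if the sweep enters the triangle through this edge and negative if
  it leaves through it; if all three vertices are level, \<open>sgn\<close> gives 0.\<close>

definition edge_jump :: "plane \<Rightarrow> plane \<Rightarrow> plane \<Rightarrow> plane \<Rightarrow> real \<Rightarrow> real" where
  "edge_jump U V W n s =
     (if n \<bullet> U = s \<and> n \<bullet> V = s then dist U V * sgn (n \<bullet> W - s) else 0)"

definition triangle_jump :: "plane \<Rightarrow> plane \<Rightarrow> plane \<Rightarrow> plane \<Rightarrow> real \<Rightarrow> real" where
  "triangle_jump U V W n s = edge_jump U V W n s + edge_jump V W U n s + edge_jump W U V n s"

lemma triangle_jump_rotate: "triangle_jump V W U n s = triangle_jump U V W n s"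
  by (simp add: triangle_jump_def)

lemma has_jump_triangle_level:
  assumes "norm n = 1" "n \<bullet> U = n \<bullet> V"
  shows "has_jump (convex hull {U, V, W}) n s (triangle_jump U V W n s)"
proof -
  have "triangle_jump U V W n s = (if s = n \<bullet> U then dist U V * sgn (n \<bullet> W - n \<bullet> U) else 0)"
    using assms by (auto simp: triangle_jump_def edge_jump_def)
  then show ?thesis
    by (simp only: has_jump_horizontal_triangle[OF assms(1) refl assms(2)[symmetric] refl])
qed

lemma has_jump_triangle:
  assumes n: "norm n = 1"
  shows "has_jump (convex hull {U, V, W}) n s (triangle_jump U V W n s)"
proof -
  consider "n \<bullet> U = n \<bullet> V" | "n \<bullet> V = n \<bullet> W" | "n \<bullet> W = n \<bullet> U"
    | "n \<bullet> U \<noteq> n \<bullet> V" "n \<bullet> V \<noteq> n \<bullet> W" "n \<bullet> W \<noteq> n \<bullet> U"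
    by blast
  then show ?thesis
  proof cases
    case 1
    then show ?thesis by (rule has_jump_triangle_level[OF n])
  next
    case 2
    from has_jump_triangle_level[OF n 2, of U s] show ?thesis
      by (simp add: triangle_jump_rotate insert_commute)
  next
    case 3
    from has_jump_triangle_level[OF n 3, of V s] show ?thesis
      by (simp add: triangle_jump_rotate[of W U V] triangle_jump_def insert_commute add_ac)
  next
    case 4
    then have "triangle_jump U V W n s = 0"
      by (auto simp: triangle_jump_def edge_jump_def)
    moreover have "has_jump (convex hull {U, V, W}) n s 0"
    proof -
      have perm: "{U, W, V} = {U, V, W}" "{V, U, W} = {U, V, W}" "{V, W, U} = {U, V, W}"
        "{W, U, V} = {U, V, W}" "{W, V, U} = {U, V, W}"
        by auto
      note sorted = has_jump_sorted_triangle[OF n]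
      consider "n \<bullet> U < n \<bullet> V" "n \<bullet> V < n \<bullet> W" | "n \<bullet> U < n \<bullet> W" "n \<bullet> W < n \<bullet> V"
        | "n \<bullet> V < n \<bullet> U" "n \<bullet> U < n \<bullet> W" | "n \<bullet> V < n \<bullet> W" "n \<bullet> W < n \<bullet> U"
        | "n \<bullet> W < n \<bullet> U" "n \<bullet> U < n \<bullet> V" | "n \<bullet> W < n \<bullet> V" "n \<bullet> V < n \<bullet> U"
        using 4 by linarith
      then show ?thesis
      proof cases
        case 1
        then show ?thesis by (rule sorted)
      next
        case 2
        from sorted[OF this] show ?thesis by (simp only: perm)
      next
        case 3
        from sorted[OF this] show ?thesis by (simp only: perm)
      next
        case 4
        from sorted[OF this] show ?thesis by (simp only: perm)
      next
        case 5
        from sorted[OF this] show ?thesis by (simp only: perm)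
      next
        case 6
        from sorted[OF this] show ?thesis by (simp only: perm)
      qed
    qed
    ultimately show ?thesis by simp
  qed
qed

section \<open>Hadwiger invariants of tilings\<close>

text \<open>An isometry is a linear map followed by a translation, so it carries the hull to the
  hull of the image vertices. It preserves inner products of difference vectors, hence angles and
  non-collinearity.\<close>

lemma congruent_triangle:
  assumes "triangle_with_angles P Q R x y z" "congruent_copy (triangle_region P Q R) T"
  obtains P' Q' R' where "T = convex hull {P', Q', R'}" "triangle_with_angles P' Q' R' x y z"
    "dist P' Q' = dist P Q" "dist Q' R' = dist Q R" "dist R' P' = dist R P"
proof -
  obtain f where f: "\<And>x y. dist (f x) (f y) = dist x y" and T: "T = f ` (convex hull {P, Q, R})"
    using assms(2) by (auto simp: congruent_copy_def triangle_region_def)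
  define g where "g x = f x - f 0" for x
  have "linear g"
    by (rule isometry_linear) (use f in \<open>auto simp: g_def dist_norm\<close>)
  have f_eq: "f = (\<lambda>x. f 0 + x) \<circ> g"
    by (auto simp: g_def)
  have hull: "T = convex hull {f P, f Q, f R}"
    unfolding T
    by (subst f_eq, subst image_comp[symmetric], subst convex_hull_linear_image[OF \<open>linear g\<close>],
        subst convex_hull_translation[symmetric]) (simp add: g_def)
  have norms: "norm (f X - f Y) = norm (X - Y)" for X Y
    using f by (simp add: dist_norm)
  have inner: "(f X - f Y) \<bullet> (f Z - f Y) = (X - Y) \<bullet> (Z - Y)" for X Y Z
    unfolding dot_norm_neg by (simp add: norms)
  have collinear: "collinear {X, Y, Z} \<longleftrightarrow>
      \<bar>(X - Y) \<bullet> (Z - Y)\<bar> = norm (X - Y) * norm (Z - Y)" for X Y Z :: plane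
    unfolding norm_cauchy_schwarz_equal by (rule collinear_3) (simp add: NO_MATCH_def)
  have "collinear {f P, f Q, f R} \<longleftrightarrow> collinear {P, Q, R}"
    unfolding collinear by (simp add: inner norms)
  then have "triangle_with_angles (f P) (f Q) (f R) x y z"
    using assms(1) by (simp add: triangle_with_angles_def vertex_angle_def inner norms)
  with hull show thesis
    by (intro that[of "f P" "f Q" "f R"]) (simp_all add: f)
qed

section \<open>Orientation, edge directions and the flux\<close>

definition cross2 :: "plane \<Rightarrow> plane \<Rightarrow> real" where
  "cross2 u v = u $ 1 * v $ 2 - u $ 2 * v $ 1"

definition perp :: "plane \<Rightarrow> plane" where
  "perp d = vector [- d $ 2, d $ 1]"

definition orient :: "plane \<Rightarrow> plane \<Rightarrow> plane \<Rightarrow> real" where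
  "orient U V W = sgn (cross2 (V - U) (W - U))"

lemma orient_rotate: "orient V W U = orient U V W"
  by (simp add: orient_def cross2_def algebra_simps)

lemma perp_inner: "perp d \<bullet> w = cross2 d w"
  by (simp add: perp_def cross2_def inner_2)

lemma norm_perp [simp]: "norm (perp d) = norm d"
  by (rule power2_eq_imp_eq) (auto simp: norm_2_square perp_def)

lemma cross2_scale: "cross2 (c *\<^sub>R u) v = c * cross2 u v"
  by (simp add: cross2_def algebra_simps)

lemma parallel_if_cross2_eq_0:
  assumes "norm d = 1" "cross2 d e = 0"
  shows "e = (d \<bullet> e) *\<^sub>R d"
proof -
  have d: "d $ 1 * d $ 1 + d $ 2 * d $ 2 = 1"
    using assms(1) norm_2_square[of d] by (simp add: power2_eq_square)
  have c: "d $ 1 * e $ 2 = d $ 2 * e $ 1"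
    using assms(2) by (simp add: cross2_def)
  have "e $ 1 = (d $ 1 * e $ 1 + d $ 2 * e $ 2) * d $ 1" "e $ 2 = (d $ 1 * e $ 1 + d $ 2 * e $ 2) * d $ 2"
    using d c by algebra+
  then show ?thesis
    by (simp add: vec_eq_iff forall_2 inner_2)
qed

lemma sgn_scaled_unit:
  fixes d :: "'a::real_normed_vector"
  assumes "norm d = 1"
  shows "sgn (c *\<^sub>R d) = sgn c *\<^sub>R d"
  using assms by (simp add: sgn_scaleR sgn_div_norm[of d])

text \<open>Only sweeps with \<open>d\<close> parallel to the edge see it. If
  \<open>V - U = k *\<^sub>R d\<close>, the indicator difference is \<open>sgn k\<close> and the
  side on which \<open>W\<close> lies is \<open>sgn k\<close> times the orientation, so the
  orientation can be separated from the direction.\<close>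

lemma edge_jump_perp:
  assumes d: "norm d = 1" and "U \<noteq> V"
  shows "edge_jump U V W (perp d) s = orient U V W * dist U V *
    (of_bool (sgn (V - U) = d) - of_bool (sgn (V - U) = - d)) * of_bool (perp d \<bullet> U = s)"
proof (cases "cross2 d (V - U) = 0")
  case True
  define k where "k = d \<bullet> (V - U)"
  have k: "V - U = k *\<^sub>R d"
    unfolding k_def using parallel_if_cross2_eq_0[OF d True] .
  then have "k \<noteq> 0" using \<open>U \<noteq> V\<close> by auto
  have d0: "d \<noteq> 0" "d \<noteq> - d"
    using d by (auto simp: eq_neg_iff_add_eq_0 simp flip: scaleR_2)
  have dir: "sgn (V - U) = sgn k *\<^sub>R d"
    unfolding k by (rule sgn_scaled_unit[OF d])
  have "of_bool (sgn (V - U) = d) - of_bool (sgn (V - U) = - d) = sgn k"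
    using \<open>k \<noteq> 0\<close> d0 unfolding dir by (cases "k > 0") auto
  moreover have "orient U V W = sgn k * sgn (perp d \<bullet> W - perp d \<bullet> U)"
    unfolding orient_def k cross2_scale sgn_mult
    by (simp add: inner_diff_right flip: perp_inner)
  moreover have "perp d \<bullet> V = perp d \<bullet> U"
    using True by (simp add: perp_inner cross2_def algebra_simps)
  moreover have "sgn k * sgn k = 1"
    using \<open>k \<noteq> 0\<close> by (simp add: sgn_if)
  ultimately show ?thesis
    by (auto simp: edge_jump_def algebra_simps)
next
  case False
  have "cross2 (sgn (V - U)) (V - U) = 0"
    unfolding sgn_div_norm cross2_scale by (simp add: cross2_def)
  moreover have "cross2 (- d) (V - U) \<noteq> 0"
    using False by (simp add: cross2_def)
  ultimately have "sgn (V - U) \<noteq> d" "sgn (V - U) \<noteq> - d"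
    using False by metis+
  moreover have "perp d \<bullet> V \<noteq> perp d \<bullet> U"
    using False by (simp add: perp_inner cross2_def algebra_simps)
  ultimately show ?thesis
    by (auto simp: edge_jump_def)
qed

text \<open>Only \<open>d = sgn (V - U)\<close> and its negative contribute. The sign of the
  indicator and the oddness of \<open>\<psi>\<close> compensate each other, so both terms are equal;
  this is the factor 2.\<close>

lemma edge_jump_sum:
  fixes \<psi> :: "plane \<Rightarrow> real"
  assumes odd: "\<And>v. \<psi> (- v) = - \<psi> v"
    and D: "finite D" "\<And>d. d \<in> D \<Longrightarrow> norm d = 1" "sgn (V - U) \<in> D" "- sgn (V - U) \<in> D"
    and S: "finite S" "\<And>d. d \<in> D \<Longrightarrow> perp d \<bullet> U \<in> S"
    and "U \<noteq> V"
  shows "(\<Sum>d\<in>D. \<Sum>s\<in>S. \<psi> d * edge_jump U V W (perp d) s) =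
    2 * (orient U V W * (\<psi> (sgn (V - U)) * dist U V))"
proof -
  define u where "u = sgn (V - U)"
  define m where "m = orient U V W * dist U V"
  have "(\<Sum>s\<in>S. \<psi> d * edge_jump U V W (perp d) s) =
      m * (\<psi> d * of_bool (d = u) - \<psi> d * of_bool (d = - u))" if "d \<in> D" for d
  proof -
    have "(\<Sum>s\<in>S. \<psi> d * edge_jump U V W (perp d) s) =
        (\<Sum>s\<in>S. if perp d \<bullet> U = s then m * (\<psi> d * of_bool (d = u) - \<psi> d * of_bool (d = - u)) else 0)"
      by (intro sum.cong refl)
        (auto simp: edge_jump_perp[OF D(2)[OF that] \<open>U \<noteq> V\<close>] u_def m_def algebra_simps of_bool_def)
    then show ?thesis
      using S that by simp
  qed
  then have "(\<Sum>d\<in>D. \<Sum>s\<in>S. \<psi> d * edge_jump U V W (perp d) s) =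
      m * ((\<Sum>d\<in>D. \<psi> d * of_bool (d = u)) - (\<Sum>d\<in>D. \<psi> d * of_bool (d = - u)))"
    by (simp add: sum_distrib_left[symmetric] sum_subtractf)
  also have "(\<Sum>d\<in>D. \<psi> d * of_bool (d = v)) = \<psi> v" if "v \<in> D" for v
  proof -
    have "(\<Sum>d\<in>D. \<psi> d * of_bool (d = v)) = (\<Sum>d\<in>D. if d = v then \<psi> d else 0)"
      by (intro sum.cong) auto
    then show ?thesis using D(1) that by simp
  qed
  then have "(\<Sum>d\<in>D. \<psi> d * of_bool (d = u)) - (\<Sum>d\<in>D. \<psi> d * of_bool (d = - u)) = 2 * \<psi> u"
    using D(3,4) odd[of u] by (simp add: u_def)
  finally show ?thesis
    by (simp add: m_def u_def)
qed

text \<open>For odd \<open>\<psi>\<close> the factor \<open>orient\<close> makes this the sum along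
  the positively oriented boundary, whatever the order of the vertices.\<close>

definition flux :: "(plane \<Rightarrow> real) \<Rightarrow> plane \<Rightarrow> plane \<Rightarrow> plane \<Rightarrow> real" where
  "flux \<psi> U V W = orient U V W *
     (\<psi> (sgn (V - U)) * dist U V + \<psi> (sgn (W - V)) * dist V W + \<psi> (sgn (U - W)) * dist W U)"

lemma triangle_jump_sum:
  fixes \<psi> :: "plane \<Rightarrow> real"
  assumes odd: "\<And>v. \<psi> (- v) = - \<psi> v"
    and D: "finite D" "\<And>d. d \<in> D \<Longrightarrow> norm d = 1"
      "\<And>u v. u \<in> X \<Longrightarrow> v \<in> X \<Longrightarrow> u \<noteq> v \<Longrightarrow> sgn (v - u) \<in> D"
    and S: "finite S" "\<And>d u. d \<in> D \<Longrightarrow> u \<in> X \<Longrightarrow> perp d \<bullet> u \<in> S"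
    and "U \<in> X" "V \<in> X" "W \<in> X" "U \<noteq> V" "V \<noteq> W" "W \<noteq> U"
  shows "(\<Sum>d\<in>D. \<Sum>s\<in>S. \<psi> d * triangle_jump U V W (perp d) s) = 2 * flux \<psi> U V W"
proof -
  have edge: "(\<Sum>d\<in>D. \<Sum>s\<in>S. \<psi> d * edge_jump u v w (perp d) s) =
      2 * (orient u v w * (\<psi> (sgn (v - u)) * dist u v))"
    if "u \<in> X" "v \<in> X" "u \<noteq> v" for u v w
  proof (rule edge_jump_sum)
    have "- sgn (v - u) = sgn (u - v)"
      by (metis minus_diff_eq sgn_minus)
    then show "- sgn (v - u) \<in> D"
      using D(3)[of v u] that by simp
  qed (use assms that in auto)
  have "orient V W U = orient U V W" "orient W U V = orient U V W"
    by (simp_all add: orient_rotate[of V W U] orient_rotate[of U V W])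
  then show ?thesis
    using assms by (simp add: triangle_jump_def distrib_left sum.distrib edge flux_def)
qed

lemma negligible_Int_if_interiors_disjoint:
  fixes S T :: "'a::euclidean_space set"
  assumes "convex S" "closed S" "convex T" "closed T" "interior S \<inter> interior T = {}"
  shows "negligible (S \<inter> T)"
proof (rule negligible_subset)
  show "negligible (frontier S \<union> frontier T)"
    using assms by (intro negligible_Un negligible_convex_frontier)
  show "S \<inter> T \<subseteq> frontier S \<union> frontier T"
    using assms by (auto simp: frontier_def)
qed

text \<open>Both sides are the jump of the swept area of one and the same region, and a limit is
  unique.\<close>

lemma triangle_jump_additive:
  fixes p q r :: "plane set \<Rightarrow> plane"
  assumes "finite \<T>" and hull: "\<And>T. T \<in> \<T> \<Longrightarrow> T = convex hull {p T, q T, r T}"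
    and disj: "pairwise (\<lambda>S T. interior S \<inter> interior T = {}) \<T>"
    and Un: "\<Union>\<T> = convex hull {A, B, C}" and n: "norm n = 1"
  shows "triangle_jump A B C n s = (\<Sum>T\<in>\<T>. triangle_jump (p T) (q T) (r T) n s)"
proof -
  have tri: "compact T" "convex T" if "T \<in> \<T>" for T
    by (subst hull[OF that], rule compact_triangle) (subst hull[OF that], rule convex_convex_hull)
  have "has_jump (\<Union>\<T>) n s (\<Sum>T\<in>\<T>. triangle_jump (p T) (q T) (r T) n s)"
  proof (rule has_jump_Union[OF \<open>finite \<T>\<close>])
    show "pairwise (\<lambda>S T. negligible (S \<inter> T)) \<T>"
      using disj tri unfolding pairwise_def
      by (auto intro!: negligible_Int_if_interiors_disjoint compact_imp_closed)
    fix T assume T: "T \<in> \<T>"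
    then show "compact T" by (rule tri)
    show "has_jump T n s (triangle_jump (p T) (q T) (r T) n s)"
      using has_jump_triangle[OF n, of "p T" "q T" "r T" s] hull[OF T] by simp
  qed
  with has_jump_triangle[OF n] show ?thesis
    unfolding Un by (rule has_jump_unique)
qed

text \<open>Summing the jumps over all sweep directions and all levels recovers twice the flux, because each side
  is met by both of its unit normals.\<close>
lemma flux_additive:
  fixes p q r :: "plane set \<Rightarrow> plane" and \<psi> :: "plane \<Rightarrow> real"
  assumes "finite \<T>" and hull: "\<And>T. T \<in> \<T> \<Longrightarrow> T = convex hull {p T, q T, r T}"
    and disj: "pairwise (\<lambda>S T. interior S \<inter> interior T = {}) \<T>"
    and Un: "\<Union>\<T> = convex hull {A, B, C}"
    and distinct: "\<And>T. T \<in> \<T> \<Longrightarrow> p T \<noteq> q T \<and> q T \<noteq> r T \<and> r T \<noteq> p T"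
    and ABC: "A \<noteq> B" "B \<noteq> C" "C \<noteq> A"
    and odd: "\<And>v. \<psi> (- v) = - \<psi> v"
  shows "flux \<psi> A B C = (\<Sum>T\<in>\<T>. flux \<psi> (p T) (q T) (r T))"
proof -
  \<comment> \<open>All vertices, all directions between them in both senses, and all levels of
    vertices: finite sets that contain every direction and level at which an edge can
    contribute.\<close>
  define X where "X = {A, B, C} \<union> p ` \<T> \<union> q ` \<T> \<union> r ` \<T>"
  define D where "D = (\<lambda>(u, v). sgn (v - u)) ` {(u, v) \<in> X \<times> X. u \<noteq> v}"
  define S where "S = (\<lambda>(d, u). perp d \<bullet> u) ` (D \<times> X)"
  have "finite X"
    using \<open>finite \<T>\<close> by (simp add: X_def)
  have "finite {(u, v) \<in> X \<times> X. u \<noteq> v}"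
    by (rule finite_subset[of _ "X \<times> X"]) (use \<open>finite X\<close> in auto)
  then have "finite D"
    unfolding D_def by (rule finite_imageI)
  have "finite S"
    unfolding S_def using \<open>finite X\<close> \<open>finite D\<close> by auto
  have unit: "norm d = 1" if "d \<in> D" for d
    using that by (auto simp: D_def norm_sgn)
  have sum: "(\<Sum>d\<in>D. \<Sum>s\<in>S. \<psi> d * triangle_jump U V W (perp d) s) = 2 * flux \<psi> U V W"
    if "U \<in> X" "V \<in> X" "W \<in> X" "U \<noteq> V" "V \<noteq> W" "W \<noteq> U" for U V W
  proof (rule triangle_jump_sum[where X = X])
    show "sgn (v - u) \<in> D" if "u \<in> X" "v \<in> X" "u \<noteq> v" for u v
      using that by (auto simp: D_def)
    show "perp d \<bullet> u \<in> S" if "d \<in> D" "u \<in> X" for d u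
      using that by (auto simp: S_def)
  qed (fact odd \<open>finite D\<close> unit \<open>finite S\<close> that)+
  have "2 * flux \<psi> A B C = (\<Sum>d\<in>D. \<Sum>s\<in>S. \<psi> d * triangle_jump A B C (perp d) s)"
    using ABC by (subst sum) (auto simp: X_def)
  also have "\<dots> = (\<Sum>d\<in>D. \<Sum>s\<in>S. \<Sum>T\<in>\<T>. \<psi> d * triangle_jump (p T) (q T) (r T) (perp d) s)"
  proof (intro sum.cong refl)
    fix d s assume "d \<in> D"
    then have "norm (perp d) = 1" by (simp add: unit)
    then show "\<psi> d * triangle_jump A B C (perp d) s =
        (\<Sum>T\<in>\<T>. \<psi> d * triangle_jump (p T) (q T) (r T) (perp d) s)"
      by (subst triangle_jump_additive[OF \<open>finite \<T>\<close> hull disj Un]) (simp_all add: sum_distrib_left)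
  qed
  also have "\<dots> = (\<Sum>T\<in>\<T>. \<Sum>d\<in>D. \<Sum>s\<in>S. \<psi> d * triangle_jump (p T) (q T) (r T) (perp d) s)"
    by (subst sum.swap[of _ _ S], subst sum.swap[of _ _ D]) (rule refl)
  also have "\<dots> = (\<Sum>T\<in>\<T>. 2 * flux \<psi> (p T) (q T) (r T))"
    using distinct by (intro sum.cong sum) (auto simp: X_def)
  finally show ?thesis
    by (simp add: sum_distrib_left[symmetric])
qed

lemma collinear_iff_cross2: "collinear {U, V, W} \<longleftrightarrow> cross2 (V - U) (W - U) = 0"
proof -
  define u w where "u = U - V" and "w = W - V"
  have "collinear {U, V, W} \<longleftrightarrow> collinear {0, u, w}"
    unfolding u_def w_def by (rule collinear_3) (simp add: NO_MATCH_def)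
  also have "\<dots> \<longleftrightarrow> (u \<bullet> w)\<^sup>2 = (norm u * norm w)\<^sup>2"
    unfolding norm_cauchy_schwarz_equal[symmetric] power2_abs[of "u \<bullet> w", symmetric]
    by (rule power2_eq_iff_nonneg[symmetric]) auto
  \<comment> \<open>Lagrange's identity: the defect in the Cauchy-Schwarz inequality is the square
    of the cross product.\<close>
  also have "(norm u * norm w)\<^sup>2 = (u \<bullet> w)\<^sup>2 + (cross2 u w)\<^sup>2"
    unfolding power_mult_distrib norm_2_square
    by (simp add: inner_2 cross2_def power2_eq_square algebra_simps)
  also have "cross2 u w = - cross2 (V - U) (W - U)"
    by (simp add: u_def w_def cross2_def algebra_simps)
  finally show ?thesis by simp
qed

section \<open>Sides of the tiled triangle as sums of tile sides\<close>

definition nat_combinations :: "real \<Rightarrow> real \<Rightarrow> real \<Rightarrow> real set" where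
  "nat_combinations a b c = {of_nat i * a + of_nat j * b + of_nat k * c | i j k. True}"

lemma nat_combinations_add:
  assumes "x \<in> nat_combinations a b c" "y \<in> nat_combinations a b c"
  shows "x + y \<in> nat_combinations a b c"
proof -
  obtain i j k i' j' k' where "x = of_nat i * a + of_nat j * b + of_nat k * c"
    "y = of_nat i' * a + of_nat j' * b + of_nat k' * c"
    using assms by (auto simp: nat_combinations_def)
  then have "x + y = of_nat (i + i') * a + of_nat (j + j') * b + of_nat (k + k') * c"
    by (simp add: algebra_simps)
  then show ?thesis
    unfolding nat_combinations_def by blast
qed

lemma nat_combinations_base:
  "0 \<in> nat_combinations a b c" "a \<in> nat_combinations a b c"
  "b \<in> nat_combinations a b c" "c \<in> nat_combinations a b c"
proof -
  have I: "of_nat i * a + of_nat j * b + of_nat k * c \<in> nat_combinations a b c" for i j k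
    unfolding nat_combinations_def by blast
  show "0 \<in> nat_combinations a b c" "a \<in> nat_combinations a b c"
    "b \<in> nat_combinations a b c" "c \<in> nat_combinations a b c"
    using I[of 0 0 0] I[of 1 0 0] I[of 0 1 0] I[of 0 0 1] by simp_all
qed

lemma nat_combinations_sum:
  "(\<And>x. x \<in> X \<Longrightarrow> f x \<in> nat_combinations a b c) \<Longrightarrow> sum f X \<in> nat_combinations a b c"
  by (induction X rule: infinite_finite_induct)
    (auto intro: nat_combinations_add nat_combinations_base)

text \<open>The jump of the swept area at the line \<open>AB\<close>: all tiles lie on one side of it, so no lengths cancel.\<close>
lemma side_nat_combination:
  fixes p q r :: "plane set \<Rightarrow> plane"
  assumes "finite \<T>" and hull: "\<And>T. T \<in> \<T> \<Longrightarrow> T = convex hull {p T, q T, r T}"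
    and disj: "pairwise (\<lambda>S T. interior S \<inter> interior T = {}) \<T>"
    and Un: "\<Union>\<T> = convex hull {A, B, C}" and "\<not> collinear {A, B, C}"
    and sides: "\<And>T. T \<in> \<T> \<Longrightarrow> dist (q T) (r T) = a \<and> dist (r T) (p T) = b \<and> dist (p T) (q T) = c"
  shows "dist A B \<in> nat_combinations a b c"
proof -
  \<comment> \<open>The unit normal of \<open>A B\<close> that points into the triangle; the
    orientation corrects the sign of the quarter turn.\<close>
  define n where "n = orient A B C *\<^sub>R perp (sgn (B - A))"
  define s where "s = n \<bullet> A"
  have cross: "cross2 (B - A) (C - A) \<noteq> 0"
    using assms(5) by (simp add: collinear_iff_cross2)
  then have "B \<noteq> A" by (auto simp: cross2_def)
  have "\<bar>orient A B C\<bar> = 1"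
    using cross by (simp add: orient_def sgn_if)
  then have "norm n = 1"
    using \<open>B \<noteq> A\<close> by (simp add: n_def norm_sgn)
  have n_inner: "n \<bullet> w = orient A B C * cross2 (B - A) w / norm (B - A)" for w
    by (simp add: n_def perp_inner sgn_div_norm cross2_scale divide_inverse)
  have "n \<bullet> (B - A) = 0"
    unfolding n_inner by (simp add: cross2_def)
  then have B: "n \<bullet> B = s"
    by (simp add: s_def inner_diff_right)
  have "n \<bullet> (C - A) = \<bar>cross2 (B - A) (C - A)\<bar> / norm (B - A)"
    unfolding n_inner orient_def by (simp add: abs_sgn mult.commute)
  then have "n \<bullet> (C - A) > 0"
    using cross \<open>B \<noteq> A\<close> by simp
  then have C: "n \<bullet> C > s"
    by (simp add: s_def inner_diff_right)
  have above: "n \<bullet> x \<ge> s" if "x \<in> convex hull {A, B, C}" for x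
    by (rule inner_ge_on_hull[OF _ that]) (use B C in \<open>auto simp: s_def\<close>)
  have "dist A B = triangle_jump A B C n s"
    using B C by (simp add: triangle_jump_def edge_jump_def flip: s_def)
  also have "\<dots> = (\<Sum>T\<in>\<T>. triangle_jump (p T) (q T) (r T) n s)"
    by (rule triangle_jump_additive[OF \<open>finite \<T>\<close> hull disj Un \<open>norm n = 1\<close>])
  also have "\<dots> \<in> nat_combinations a b c"
  proof (rule nat_combinations_sum)
    fix T assume T: "T \<in> \<T>"
    have "{p T, q T, r T} \<subseteq> convex hull {A, B, C}"
      using hull_subset[of "{p T, q T, r T}" convex] hull[OF T] T Un by blast
    then have vert: "n \<bullet> p T \<ge> s" "n \<bullet> q T \<ge> s" "n \<bullet> r T \<ge> s"
      using above by auto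
    have edge: "edge_jump U V W n s \<in> {0, dist U V}" if "n \<bullet> W \<ge> s" for U V W
      using that by (auto simp: edge_jump_def sgn_if)
    have "edge_jump (p T) (q T) (r T) n s \<in> nat_combinations a b c"
      "edge_jump (q T) (r T) (p T) n s \<in> nat_combinations a b c"
      "edge_jump (r T) (p T) (q T) n s \<in> nat_combinations a b c"
      using edge[OF vert(3), of "p T" "q T"] edge[OF vert(1), of "q T" "r T"]
        edge[OF vert(2), of "r T" "p T"] sides[OF T] nat_combinations_base[of _ _ _]
      by auto
    then show "triangle_jump (p T) (q T) (r T) n s \<in> nat_combinations a b c"
      unfolding triangle_jump_def by (intro nat_combinations_add)
  qed
  finally show ?thesis .
qed

section \<open>The character on directions\<close>

text \<open>On the orbit of \<open>z0\<close> under both rotations, \<open>\<psi>\<close> is 1 or -1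
  according to the parity of the number of turns by \<open>pi / 3\<close>; off the orbit it is 0.
  Irrationality of \<alpha> / pi makes that parity well defined.\<close>

lemma exists_character:
  fixes \<alpha> :: real and z0 :: complex
  assumes irrational: "\<alpha> / pi \<notin> \<rat>" and "z0 \<noteq> 0"
  obtains \<psi> :: "complex \<Rightarrow> real" where "\<psi> z0 = 1" "\<And>u. \<psi> u \<in> \<int>"
    "\<And>u. \<psi> (u * cis \<alpha>) = \<psi> u" "\<And>u. \<psi> (u * cis (pi / 3)) = - \<psi> u"
proof -
  define dir where "dir k j = z0 * cis (of_int k * \<alpha> + of_int j * (pi / 3))" for k j :: int
  define E where "E u \<longleftrightarrow> (\<exists>k j. even j \<and> u = dir k j)" for u
  define Od where "Od u \<longleftrightarrow> (\<exists>k j. odd j \<and> u = dir k j)" for u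
  define \<psi> :: "complex \<Rightarrow> real" where "\<psi> u = (if E u then 1 else if Od u then - 1 else 0)" for u
  have parity: "even j \<longleftrightarrow> even j'" if "dir k j = dir k' j'" for k j k' j'
  proof -
    from that \<open>z0 \<noteq> 0\<close> have "cis (of_int k * \<alpha> + of_int j * (pi / 3)) = cis (of_int k' * \<alpha> + of_int j' * (pi / 3))"
      by (simp add: dir_def)
    then obtain m :: int where
      "of_int k * \<alpha> + of_int j * (pi / 3) = of_int k' * \<alpha> + of_int j' * (pi / 3) + 2 * pi * of_int m"
      using sin_cos_eq_iff by (auto simp: complex_eq_iff)
    \<comment> \<open>If \<open>k\<close> and \<open>k'\<close> differed, this would make \<alpha> /
      pi rational. If they agree, \<open>j\<close> and \<open>j'\<close> differ by a multiple of 6,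
      since a full turn is six turns by \<open>pi / 3\<close>; so the parity is the same.\<close>
    then have m: "3 * of_int (k - k') * \<alpha> = of_int (j' - j + 6 * m) * pi"
      by (simp add: algebra_simps)
    have "k = k'"
    proof (rule ccontr)
      assume "k \<noteq> k'"
      then have "\<alpha> / pi = of_int (j' - j + 6 * m) / of_int (3 * (k - k'))"
        using m by (simp add: field_simps)
      also have "\<dots> \<in> \<rat>" by (intro Rats_divide Rats_of_int)
      finally show False using irrational by simp
    qed
    with m have "j' - j + 6 * m = 0"
      by (simp flip: of_int_eq_0_iff)
    then have "j = j' + 2 * (3 * m)" by simp
    then show ?thesis by simp
  qed
  then have excl: "\<not> (E u \<and> Od u)" for u
    unfolding E_def Od_def by metis
  have rot: "u * cis \<alpha> = dir k j \<longleftrightarrow> u = dir (k - 1) j"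
    "u * cis (pi / 3) = dir k j \<longleftrightarrow> u = dir k (j - 1)" for u k j
  proof -
    have eq: "dir k j = dir (k - 1) j * cis \<alpha>" "dir k j = dir k (j - 1) * cis (pi / 3)"
    proof -
      have "of_int k * \<alpha> + of_int j * (pi / 3) = of_int (k - 1) * \<alpha> + of_int j * (pi / 3) + \<alpha>"
        "of_int k * \<alpha> + of_int j * (pi / 3) = of_int k * \<alpha> + of_int (j - 1) * (pi / 3) + pi / 3"
        by (simp_all add: field_simps)
      then show "dir k j = dir (k - 1) j * cis \<alpha>" "dir k j = dir k (j - 1) * cis (pi / 3)"
        unfolding dir_def mult.assoc cis_mult by metis+
    qed
    show "u * cis \<alpha> = dir k j \<longleftrightarrow> u = dir (k - 1) j"
      unfolding eq(1) by simp
    show "u * cis (pi / 3) = dir k j \<longleftrightarrow> u = dir k (j - 1)"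
      unfolding eq(2) by simp
  qed
  have shift: "(\<exists>k. P (k - 1)) \<longleftrightarrow> (\<exists>k. P k)" for P :: "int \<Rightarrow> bool"
    by (metis add_diff_cancel_right')
  have "E (u * cis \<alpha>) = E u" "Od (u * cis \<alpha>) = Od u" for u
    unfolding E_def Od_def rot using shift[of "\<lambda>k. \<exists>j. even j \<and> u = dir k j"]
      shift[of "\<lambda>k. \<exists>j. odd j \<and> u = dir k j"] by simp_all
  moreover have "E (u * cis (pi / 3)) = Od u" "Od (u * cis (pi / 3)) = E u" for u
  proof -
    have "(\<exists>j. even j \<and> u = dir k (j - 1)) \<longleftrightarrow> (\<exists>j. odd j \<and> u = dir k j)"
      "(\<exists>j. odd j \<and> u = dir k (j - 1)) \<longleftrightarrow> (\<exists>j. even j \<and> u = dir k j)" for k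
      using shift[of "\<lambda>j. odd j \<and> u = dir k j"] shift[of "\<lambda>j. even j \<and> u = dir k j"] by simp_all
    then show "E (u * cis (pi / 3)) = Od u" "Od (u * cis (pi / 3)) = E u"
      unfolding E_def Od_def rot by simp_all
  qed
  moreover have "E z0"
    unfolding E_def dir_def by (intro exI[of _ 0]) simp
  ultimately show thesis
    using excl by (intro that[of \<psi>]) (auto simp: \<psi>_def)
qed

section \<open>Vertex angles as rotations of directions\<close>

lemma vertex_angle_argument_bound:
  fixes u v :: "'a::real_inner"
  shows "\<bar>u \<bullet> v / (norm u * norm v)\<bar> \<le> 1"
  using Cauchy_Schwarz_ineq2[of u v]
  by (cases "u = 0 \<or> v = 0") (auto simp: abs_divide abs_mult divide_le_eq_1)

lemma inner_vertex_angle: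
  "(X - Y) \<bullet> (Z - Y) = dist X Y * dist Z Y * cos (vertex_angle X Y Z)"
  unfolding vertex_angle_def cos_arccos_abs[OF vertex_angle_argument_bound]
  by (simp add: dist_norm)

lemma vertex_angle_commute: "vertex_angle X Y Z = vertex_angle Z Y X"
  by (simp add: vertex_angle_def inner_commute mult.commute)

definition to_complex :: "plane \<Rightarrow> complex" where
  "to_complex v = Complex (v $ 1) (v $ 2)"

lemma to_complex_uminus: "to_complex (- v) = - to_complex v"
  by (simp add: to_complex_def complex_eq_iff)

lemma norm_to_complex: "norm (to_complex v) = norm v"
  by (rule power2_eq_imp_eq) (auto simp: norm_2_square to_complex_def cmod_power2)

text \<open>The quotient \<open>v / u\<close> equals \<open>v * cnj u\<close> for unit vectors, and
  its real part determines it up to conjugation.\<close>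

lemma unit_complex_rotation:
  fixes u v :: complex
  assumes "norm u = 1" "norm v = 1" "Re (v * cnj u) = cos \<phi>"
  shows "v = u * cis \<phi> \<or> v = u * cis (- \<phi>)"
proof -
  define w where "w = v * cnj u"
  have "norm w = 1"
    using assms by (simp add: w_def norm_mult)
  then have "(Re w)\<^sup>2 + (Im w)\<^sup>2 = 1"
    by (simp flip: cmod_power2)
  then have "(Im w)\<^sup>2 = (sin \<phi>)\<^sup>2"
    using assms(3) unfolding w_def[symmetric] by (simp add: sin_squared_eq)
  then have "w = cis \<phi> \<or> w = cis (- \<phi>)"
    using assms(3) by (auto simp: power2_eq_iff complex_eq_iff w_def)
  moreover have "u * w = v"
  proof -
    have "u * cnj u = 1"
      using assms(1) by (simp add: complex_norm_square[symmetric])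
    then show ?thesis
      by (simp add: w_def mult.left_commute)
  qed
  ultimately show ?thesis by auto
qed

lemma direction_rotation:
  assumes "X \<noteq> Y" "Z \<noteq> Y" "vertex_angle X Y Z = \<phi>"
  shows "to_complex (sgn (Z - Y)) = to_complex (sgn (X - Y)) * cis \<phi> \<or>
    to_complex (sgn (Z - Y)) = to_complex (sgn (X - Y)) * cis (- \<phi>)"
proof (rule unit_complex_rotation)
  have "Re (to_complex (sgn (Z - Y)) * cnj (to_complex (sgn (X - Y)))) = sgn (X - Y) \<bullet> sgn (Z - Y)"
    by (simp add: to_complex_def inner_2 mult.commute)
  also have "\<dots> = cos \<phi>"
    unfolding sgn_div_norm inner_scaleR_left inner_scaleR_right inner_vertex_angle assms(3)
    using assms(1,2) by (simp add: dist_norm field_simps)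
  finally show "Re (to_complex (sgn (Z - Y)) * cnj (to_complex (sgn (X - Y)))) = cos \<phi>" .
qed (use assms in \<open>auto simp: norm_to_complex norm_sgn\<close>)

text \<open>Unoriented angles suffice, since the character does not distinguish the rotations by \<open>\<phi>\<close> and \<open>- \<phi>\<close>.\<close>
lemma character_angle:
  fixes \<psi> :: "complex \<Rightarrow> real"
  assumes "X \<noteq> Y" "Z \<noteq> Y" "vertex_angle X Y Z = \<phi>"
    and rot: "\<And>u. \<psi> (u * cis \<phi>) = e * \<psi> u" and "e * e = 1"
  shows "\<psi> (to_complex (sgn (Z - Y))) = e * \<psi> (to_complex (sgn (X - Y)))"
proof -
  have "\<psi> (u * cis (- \<phi>)) = e * \<psi> u" for u
  proof -
    have "\<psi> u = e * \<psi> (u * cis (- \<phi>))"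
      using rot[of "u * cis (- \<phi>)"] by (simp add: mult.assoc cis_mult)
    then show ?thesis
      using \<open>e * e = 1\<close> by (simp flip: mult.assoc)
  qed
  with direction_rotation[OF assms(1-3)] rot show ?thesis by auto
qed

section \<open>The integer relation between the side lengths\<close>

lemma triangle_with_angles_distinct:
  assumes "triangle_with_angles A B C x y z"
  shows "A \<noteq> B" "B \<noteq> C" "C \<noteq> A"
  using assms by (auto simp: triangle_with_angles_def insert_commute)

lemma tiling_triangles:
  assumes "triangle_with_angles P Q R x y z" "tiling_by \<T> (triangle_region P Q R) K"
  obtains p q r where
    "\<And>T. T \<in> \<T> \<Longrightarrow> T = convex hull {p T, q T, r T}"
    "\<And>T. T \<in> \<T> \<Longrightarrow> triangle_with_angles (p T) (q T) (r T) x y z"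
    "\<And>T. T \<in> \<T> \<Longrightarrow> dist (q T) (r T) = dist Q R \<and> dist (r T) (p T) = dist R P \<and>
      dist (p T) (q T) = dist P Q"
proof -
  have "\<exists>p q r. T = convex hull {p, q, r} \<and> triangle_with_angles p q r x y z \<and>
      dist q r = dist Q R \<and> dist r p = dist R P \<and> dist p q = dist P Q" if "T \<in> \<T>" for T
    using congruent_triangle[OF assms(1), of T] assms(2) that unfolding tiling_by_def by metis
  then show thesis
    using that by metis
qed

text \<open>Turning by \<alpha> or 2 \<alpha> keeps the character, turning by \<beta> or
  \<open>pi / 3\<close> negates it. Going round a triangle, this gives the first two sides equal
  signs and the third the opposite one, both for each tile and for \<open>A B C\<close>.\<close>

lemma integer_relation:
  assumes tile: "triangle_with_angles P Q R \<alpha> \<beta> (2 * pi / 3)"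
    and irrational: "\<alpha> / pi \<notin> \<rat>" and sum: "\<alpha> + \<beta> = pi / 3"
    and ABC: "triangle_with_angles A B C (2 * \<alpha>) (pi / 3) (2 * \<beta>)"
    and tiling: "tiling_by \<T> (triangle_region P Q R) (triangle_region A B C)"
  shows "\<exists>n :: int. dist A B + dist B C - dist C A = of_int n * (dist P Q + dist Q R - dist R P)"
proof -
  obtain p q r where
    hull: "\<And>T. T \<in> \<T> \<Longrightarrow> T = convex hull {p T, q T, r T}"
    and angles: "\<And>T. T \<in> \<T> \<Longrightarrow> triangle_with_angles (p T) (q T) (r T) \<alpha> \<beta> (2 * pi / 3)"
    and sides: "\<And>T. T \<in> \<T> \<Longrightarrow> dist (q T) (r T) = dist Q R \<and> dist (r T) (p T) = dist R P \<and>
      dist (p T) (q T) = dist P Q"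
    using tiling_triangles[OF tile tiling] by metis
  note ABC' = triangle_with_angles_distinct[OF ABC]
  \<comment> \<open>The character is normalised on the direction of \<open>A B\<close>, so that the
    flux of the big triangle cannot vanish merely because its directions miss the orbit.\<close>
  define z0 where "z0 = to_complex (sgn (B - A))"
  have "norm z0 = 1"
    using ABC' by (simp add: z0_def norm_to_complex norm_sgn)
  then have "z0 \<noteq> 0" by auto
  obtain \<kappa> :: "complex \<Rightarrow> real" where base: "\<kappa> z0 = 1" and Ints: "\<And>u. \<kappa> u \<in> \<int>"
    and rot: "\<And>u. \<kappa> (u * cis \<alpha>) = \<kappa> u" "\<And>u. \<kappa> (u * cis (pi / 3)) = - \<kappa> u"
    using exists_character[OF irrational \<open>z0 \<noteq> 0\<close>] by metis
  define \<psi> where "\<psi> v = \<kappa> (to_complex v)" for v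
  have rot2: "\<kappa> (u * cis (2 * \<alpha>)) = \<kappa> u" for u
    using rot(1)[of "u * cis \<alpha>"] rot(1)[of u] by (simp add: mult.assoc cis_mult)
  have rot\<beta>: "\<kappa> (u * cis \<beta>) = - \<kappa> u" for u
  proof -
    have "\<kappa> (u * cis \<beta> * cis \<alpha>) = - \<kappa> u"
      using rot(2)[of u] unfolding sum[symmetric] by (simp add: mult.assoc cis_mult add.commute)
    then show ?thesis by (simp only: rot)
  qed
  have odd: "\<psi> (- v) = - \<psi> v" for v
  proof -
    \<comment> \<open>A half turn is three turns by \<open>pi / 3\<close>, an odd number of sign
      changes.\<close>
    have "\<kappa> (u * cis (pi / 3) * cis (pi / 3) * cis (pi / 3)) = - \<kappa> u" for u
      by (simp only: rot minus_minus)
    then have "\<kappa> (- u) = - \<kappa> u" for u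
      by (simp add: mult.assoc cis_mult)
    then show ?thesis by (simp add: \<psi>_def to_complex_uminus)
  qed
  have flip: "\<psi> (sgn (v - u)) = - \<psi> (sgn (u - v))" for u v
    using odd[of "sgn (u - v)"] by (simp flip: sgn_minus)
  have "flux \<psi> A B C = orient A B C * (dist A B + dist B C - dist C A)"
  proof -
    have 1: "\<psi> (sgn (B - A)) = 1" using base by (simp add: \<psi>_def z0_def)
    moreover have "\<psi> (sgn (B - A)) = \<psi> (sgn (C - A))"
      using character_angle[of C A B "2 * \<alpha>" \<kappa> 1] ABC ABC' rot2
      by (simp add: triangle_with_angles_def \<psi>_def)
    moreover have "\<psi> (sgn (C - B)) = - \<psi> (sgn (A - B))"
      using character_angle[of A B C "pi / 3" \<kappa> "- 1"] ABC ABC' rot(2)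
      by (simp add: triangle_with_angles_def \<psi>_def)
    ultimately show ?thesis
      using flip[of A B] flip[of A C] by (simp add: flux_def)
  qed
  moreover have "\<exists>m :: int. flux \<psi> (p T) (q T) (r T) = of_int m * (dist P Q + dist Q R - dist R P)"
    if T: "T \<in> \<T>" for T
  proof -
    note tri = angles[OF T, unfolded triangle_with_angles_def]
    note dis = triangle_with_angles_distinct[OF angles[OF T]]
    have "\<psi> (sgn (q T - p T)) = \<psi> (sgn (r T - p T))"
      using character_angle[of "r T" "p T" "q T" \<alpha> \<kappa> 1] tri dis rot(1) by (simp add: \<psi>_def)
    moreover have "\<psi> (sgn (r T - q T)) = - \<psi> (sgn (p T - q T))"
      using character_angle[of "p T" "q T" "r T" \<beta> \<kappa> "- 1"] tri dis rot\<beta> by (simp add: \<psi>_def)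
    ultimately have "flux \<psi> (p T) (q T) (r T) = orient (p T) (q T) (r T) * \<psi> (sgn (q T - p T)) *
        (dist P Q + dist Q R - dist R P)"
      using flip[of "q T" "p T"] flip[of "r T" "p T"] sides[OF T]
      by (simp add: flux_def algebra_simps)
    moreover have "orient (p T) (q T) (r T) * \<psi> (sgn (q T - p T)) \<in> \<int>"
      using Ints by (auto simp: \<psi>_def orient_def sgn_if intro!: Ints_mult)
    ultimately show ?thesis
      by (metis Ints_cases)
  qed
  then obtain m :: "plane set \<Rightarrow> int" where
    "\<And>T. T \<in> \<T> \<Longrightarrow> flux \<psi> (p T) (q T) (r T) = of_int (m T) * (dist P Q + dist Q R - dist R P)"
    by metis
  moreover have "flux \<psi> A B C = (\<Sum>T\<in>\<T>. flux \<psi> (p T) (q T) (r T))"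
    using tiling triangle_with_angles_distinct[OF angles] ABC' odd
    by (intro flux_additive hull) (auto simp: tiling_by_def triangle_region_def)
  ultimately have eq: "orient A B C * (dist A B + dist B C - dist C A) =
      of_int (\<Sum>T\<in>\<T>. m T) * (dist P Q + dist Q R - dist R P)"
    by (simp add: sum_distrib_right)
  have "orient A B C = 1 \<or> orient A B C = - 1"
    using ABC by (auto simp: triangle_with_angles_def collinear_iff_cross2 orient_def sgn_if)
  then show ?thesis
  proof
    assume "orient A B C = 1"
    with eq show ?thesis by (intro exI[of _ "\<Sum>T\<in>\<T>. m T"]) simp
  next
    assume "orient A B C = - 1"
    with eq show ?thesis by (intro exI[of _ "- (\<Sum>T\<in>\<T>. m T)"]) simp
  qed
qed

section \<open>Metric relations and conclusion\<close>

lemma triangle_projection: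
  assumes "A \<noteq> B"
  shows "dist A B = dist C A * cos (vertex_angle C A B) + dist B C * cos (vertex_angle A B C)"
proof -
  have "dist A B * dist A B = (C - A) \<bullet> (B - A) + (A - B) \<bullet> (C - B)"
  proof -
    have "dist A B * dist A B = (A - B) \<bullet> (A - B)"
      by (simp add: dist_norm norm_eq_sqrt_inner)
    then show ?thesis
      by (simp add: inner_diff_left inner_diff_right inner_commute)
  qed
  also have "\<dots> = dist A B * (dist C A * cos (vertex_angle C A B) + dist B C * cos (vertex_angle A B C))"
    unfolding inner_vertex_angle by (simp add: dist_commute algebra_simps)
  finally show ?thesis
    using assms by simp
qed

lemma triangle_projections:
  assumes "triangle_with_angles A B C x y z"
  shows "dist A B = dist C A * cos x + dist B C * cos y"
    "dist B C = dist A B * cos y + dist C A * cos z"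
    "dist C A = dist B C * cos z + dist A B * cos x"
proof -
  have angles: "vertex_angle C A B = x" "vertex_angle A B C = y" "vertex_angle B C A = z"
    using assms by (simp_all add: triangle_with_angles_def)
  note distinct = triangle_with_angles_distinct[OF assms]
  show "dist A B = dist C A * cos x + dist B C * cos y"
    using triangle_projection[OF distinct(1), of C] unfolding angles .
  show "dist B C = dist A B * cos y + dist C A * cos z"
    using triangle_projection[OF distinct(2), of A] unfolding angles .
  show "dist C A = dist B C * cos z + dist A B * cos x"
    using triangle_projection[OF distinct(3), of B] unfolding angles .
qed

lemma triangle_with_angles_bounds:
  assumes "triangle_with_angles A B C x y z"
  shows "0 \<le> x" "x \<le> pi" "0 \<le> y" "y \<le> pi" "0 \<le> z" "z \<le> pi"
proof -
  have "0 \<le> vertex_angle X Y Z \<and> vertex_angle X Y Z \<le> pi" for X Y Z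
    using vertex_angle_argument_bound[of "X - Y" "Z - Y"] unfolding vertex_angle_def abs_le_iff
    by (intro conjI arccos_lbound arccos_ubound) auto
  then show "0 \<le> x" "x \<le> pi" "0 \<le> y" "y \<le> pi" "0 \<le> z" "z \<le> pi"
    using assms unfolding triangle_with_angles_def by metis+
qed

lemma tile_relations:
  assumes "triangle_with_angles P Q R \<alpha> \<beta> (2 * pi / 3)"
  defines "a \<equiv> dist Q R" and "b \<equiv> dist R P" and "c \<equiv> dist P Q"
  shows "0 < a" "0 < b" "0 < c" "c\<^sup>2 = a\<^sup>2 + a * b + b\<^sup>2"
    and "cos \<alpha> = (b + a / 2) / c" "cos \<beta> = (a + b / 2) / c" "\<alpha> + \<beta> = pi / 3"
proof -
  show pos: "0 < a" "0 < b" "0 < c"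
    using triangle_with_angles_distinct[OF assms(1)] by (auto simp: a_def b_def c_def)
  note proj = triangle_projections[OF assms(1), folded a_def b_def c_def]
  have b: "c * cos \<alpha> = b + a / 2" and a: "c * cos \<beta> = a + b / 2"
    using proj(2,3) by (simp_all add: cos_120)
  show cos: "cos \<alpha> = (b + a / 2) / c" "cos \<beta> = (a + b / 2) / c"
    using a b pos by (simp_all add: field_simps)
  show c: "c\<^sup>2 = a\<^sup>2 + a * b + b\<^sup>2"
  proof -
    have "c * c = b * (c * cos \<alpha>) + a * (c * cos \<beta>)"
      using arg_cong[OF proj(1), of "(*) c"] by (simp add: algebra_simps)
    then show ?thesis
      unfolding a b by (simp add: power2_eq_square algebra_simps)
  qed
  note bounds = triangle_with_angles_bounds[OF assms(1)]
  \<comment> \<open>Acute angles have a sum in [0, pi], where the cosine is injective; so computing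
    the cosine of \<alpha> + \<beta> as 1/2 will identify the sum.\<close>
  have acute: "x < pi / 2" if "x \<le> pi" "cos x > 0" for x :: real
    using that cos_monotone_0_pi_le[of "pi / 2" x] by (force simp: not_less)
  have "cos \<alpha> > 0" "cos \<beta> > 0"
    unfolding cos using pos by (simp_all add: add_pos_pos)
  then have "\<alpha> < pi / 2" "\<beta> < pi / 2"
    using bounds by (simp_all only: acute)
  have sin: "sin \<alpha> = sqrt 3 / 2 * a / c" "sin \<beta> = sqrt 3 / 2 * b / c"
  proof -
    have *: "1 - (x / c)\<^sup>2 = (c\<^sup>2 - x\<^sup>2) / c\<^sup>2" for x
      using pos by (simp add: power_divide diff_divide_distrib)
    have **: "c\<^sup>2 - (b + a / 2)\<^sup>2 = 3 / 4 * a\<^sup>2" "c\<^sup>2 - (a + b / 2)\<^sup>2 = 3 / 4 * b\<^sup>2"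
      unfolding c by (simp_all add: power2_eq_square field_simps)
    have "(sin \<alpha>)\<^sup>2 = (sqrt 3 / 2 * a / c)\<^sup>2" "(sin \<beta>)\<^sup>2 = (sqrt 3 / 2 * b / c)\<^sup>2"
      unfolding sin_squared_eq cos * ** by (simp_all add: power_divide power_mult_distrib)
    then show "sin \<alpha> = sqrt 3 / 2 * a / c" "sin \<beta> = sqrt 3 / 2 * b / c"
      using bounds pos by (auto intro!: power2_eq_imp_eq sin_ge_zero)
  qed
  have "cos (\<alpha> + \<beta>) = ((b + a / 2) * (a + b / 2) - 3 / 4 * a * b) / c\<^sup>2"
    unfolding cos_add cos sin by (simp add: power2_eq_square diff_divide_distrib)
  also have "\<dots> = 1 / 2"
  proof -
    have "(b + a / 2) * (a + b / 2) - 3 / 4 * a * b = c\<^sup>2 / 2"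
      unfolding c by (simp add: power2_eq_square field_simps)
    then show ?thesis using pos by simp
  qed
  finally have "cos (\<alpha> + \<beta>) = cos (pi / 3)"
    by (simp add: cos_60)
  then show "\<alpha> + \<beta> = pi / 3"
    using bounds \<open>\<alpha> < pi / 2\<close> \<open>\<beta> < pi / 2\<close> cos_inj_pi[of "\<alpha> + \<beta>" "pi / 3"] by simp
qed

text \<open>With the cosines of 2 \<alpha> and 2 \<beta> expressed by the tile sides, two of the
  projection formulas form a linear system for \<open>dist A B\<close> and \<open>dist B C\<close>
  in terms of \<open>dist C A\<close>.\<close>

lemma big_triangle_sides:
  assumes tile: "triangle_with_angles P Q R \<alpha> \<beta> (2 * pi / 3)"
    and ABC: "triangle_with_angles A B C (2 * \<alpha>) (pi / 3) (2 * \<beta>)"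
  defines "a \<equiv> dist Q R" and "b \<equiv> dist R P" and "c \<equiv> dist P Q"
  shows "dist A B = dist C A * (b\<^sup>2 + 2 * a * b) / c\<^sup>2"
    and "dist B C = dist C A * (a\<^sup>2 + 2 * a * b) / c\<^sup>2"
proof -
  note rel = tile_relations[OF tile, folded a_def b_def c_def]
  note proj = triangle_projections[OF ABC]
  define X Y Z where "X = dist B C" and "Y = dist C A" and "Z = dist A B"
  have c: "c \<noteq> 0" using rel(3) by simp
  have "cos (2 * \<alpha>) * c\<^sup>2 = 2 * (b + a / 2)\<^sup>2 - c\<^sup>2" "cos (2 * \<beta>) * c\<^sup>2 = 2 * (a + b / 2)\<^sup>2 - c\<^sup>2"
    unfolding cos_double_cos rel(5,6) using c by (simp_all add: field_simps)
  moreover have "Z = Y * cos (2 * \<alpha>) + X / 2" "X = Z / 2 + Y * cos (2 * \<beta>)"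
    using proj(1,2) by (simp_all add: X_def Y_def Z_def cos_60)
  ultimately have "Z * c\<^sup>2 = Y * (2 * (b + a / 2)\<^sup>2 - c\<^sup>2) + X * c\<^sup>2 / 2"
    "X * c\<^sup>2 = Z * c\<^sup>2 / 2 + Y * (2 * (a + b / 2)\<^sup>2 - c\<^sup>2)"
    by (metis (no_types, opaque_lifting) distrib_right mult.assoc times_divide_eq_left)+
  moreover have "Y * (2 * (b + a / 2)\<^sup>2 - c\<^sup>2) = Y * b\<^sup>2 + Y * (a * b) - Y * a\<^sup>2 / 2"
    "Y * (2 * (a + b / 2)\<^sup>2 - c\<^sup>2) = Y * a\<^sup>2 + Y * (a * b) - Y * b\<^sup>2 / 2"
    unfolding rel(4) by (simp_all add: power2_eq_square algebra_simps)
  ultimately have "Z * c\<^sup>2 = Y * b\<^sup>2 + 2 * (Y * (a * b))" "X * c\<^sup>2 = Y * a\<^sup>2 + 2 * (Y * (a * b))"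
    by linarith+
  then have "Z = Y * (b\<^sup>2 + 2 * a * b) / c\<^sup>2" "X = Y * (a\<^sup>2 + 2 * a * b) / c\<^sup>2"
    using c by (simp_all add: eq_divide_eq distrib_left ac_simps)
  then show "dist A B = dist C A * (b\<^sup>2 + 2 * a * b) / c\<^sup>2"
    "dist B C = dist C A * (a\<^sup>2 + 2 * a * b) / c\<^sup>2"
    by (simp_all add: X_def Y_def Z_def)
qed

text \<open>The common left side of \<open>m\<close> and \<open>n\<close> is the excess of |AB| +
  |BC| over |CA| = \<open>Y\<close>, and \<open>Z\<close> concerns |AB|. The case
  \<open>a < b\<close> is reached by exchanging \<open>a\<close> and \<open>b\<close>, which turns
  |AB| into |BC|.\<close>

lemma rational_side_ratios:
  fixes a b c Y :: real and m n :: int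
  assumes pos: "0 < b" "b < a" "0 < c" "0 < Y" and c: "c\<^sup>2 = a\<^sup>2 + a * b + b\<^sup>2"
    and m: "3 * a * b * Y / c\<^sup>2 = of_int m * (c + a - b)"
    and n: "3 * a * b * Y / c\<^sup>2 = of_int n * (c + b - a)"
    and Z: "Y * (b\<^sup>2 + 2 * a * b) / c\<^sup>2 \<in> nat_combinations a b c"
  shows "a / c \<in> \<rat>" "b / c \<in> \<rat>"
proof -
  define s t y where "s = (a - b) / c" and "t = (a + b) / c" and "y = Y / c"
  have a: "a = c * ((t + s) / 2)" and b: "b = c * ((t - s) / 2)" and Y: "Y = c * y"
    using pos by (simp_all add: s_def t_def y_def field_simps)
  have "a\<^sup>2 < c\<^sup>2" using c pos by (simp add: add_pos_pos)
  then have "a < c" using pos by (simp add: power2_less_imp_less)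
  then have s: "0 < s" "s < 1" using pos by (auto simp: s_def field_simps)
  have y: "0 < y" using pos by (simp add: y_def)
  \<comment> \<open>The law of cosines in the variables \<open>s\<close> and \<open>t\<close>; it
    eliminates \<open>t\<^sup>2\<close>, so that \<open>t\<close> occurs at most linearly
    below.\<close>
  have t2: "3 * t\<^sup>2 = 4 - s\<^sup>2"
  proof -
    have "c\<^sup>2 = (c * ((t + s) / 2))\<^sup>2 + c * ((t + s) / 2) * (c * ((t - s) / 2)) + (c * ((t - s) / 2))\<^sup>2"
      unfolding a[symmetric] b[symmetric] by (rule c)
    then have "c\<^sup>2 * (4 - s\<^sup>2) = c\<^sup>2 * (3 * t\<^sup>2)"
      by (simp add: power2_eq_square field_simps)
    then show ?thesis using pos by simp
  qed
  have ab: "3 * a * b * Y / c\<^sup>2 = c * (y * (1 - s\<^sup>2))"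
  proof -
    have "3 * a * b * Y = c ^ 3 * (y * (3 * t\<^sup>2 - 3 * s\<^sup>2) / 4)"
      unfolding a b Y by (simp add: field_simps power2_eq_square power3_eq_cube)
    also have "\<dots> = c\<^sup>2 * (c * (y * (1 - s\<^sup>2)))"
      unfolding t2 by (simp add: field_simps power2_eq_square power3_eq_cube)
    finally show ?thesis using pos by simp
  qed
  have "c + a - b = c * (1 + s)" "c + b - a = c * (1 - s)"
    using pos by (simp_all add: s_def field_simps)
  with m n pos have m': "y * (1 - s\<^sup>2) = of_int m * (1 + s)" and n': "y * (1 - s\<^sup>2) = of_int n * (1 - s)"
    unfolding ab by simp_all
  have "1 - s\<^sup>2 = (1 - s) * (1 + s)"
    by (simp add: power2_eq_square algebra_simps)
  \<comment> \<open>Both factors of \<open>1 - s\<^sup>2\<close> are nonzero because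
    \<open>0 < s\<close> and \<open>s < 1\<close>. Sum and difference of the resulting integers give
    \<open>y\<close> and \<open>s\<close>.\<close>
  with m' n' s have m'': "y * (1 - s) = of_int m" and n'': "y * (1 + s) = of_int n"
    by (simp_all add: mult.commute mult.left_commute)
  have "y = of_int (m + n) / 2"
    using m'' n'' by (simp add: field_simps)
  then have "y \<in> \<rat>"
    by (simp only: Rats_divide Rats_of_int Rats_number_of)
  have "s = of_int (n - m) / 2 / y"
    using m'' n'' y by (simp add: field_simps)
  then have "s \<in> \<rat>"
    using \<open>y \<in> \<rat>\<close> by (simp only: Rats_divide Rats_of_int Rats_number_of)
  have "Y * (b\<^sup>2 + 2 * a * b) / c\<^sup>2 = c * (y * (1 - s\<^sup>2 / 2 - t * s / 2))"
  proof -
    have "Y * (b\<^sup>2 + 2 * a * b) = c ^ 3 * (y * (3 * t\<^sup>2 - s\<^sup>2 - 2 * t * s) / 4)"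
      unfolding a b Y by (simp add: field_simps power2_eq_square power3_eq_cube)
    also have "\<dots> = c\<^sup>2 * (c * (y * (1 - s\<^sup>2 / 2 - t * s / 2)))"
      unfolding t2 by (simp add: field_simps power2_eq_square power3_eq_cube)
    finally show ?thesis using pos by simp
  qed
  then obtain i j k :: nat where "c * (y * (1 - s\<^sup>2 / 2 - t * s / 2)) =
      of_nat i * a + of_nat j * b + of_nat k * c"
    using Z by (auto simp: nat_combinations_def)
  also have "\<dots> = c * (of_nat i * ((t + s) / 2) + of_nat j * ((t - s) / 2) + of_nat k)"
    by (subst a, subst b) (simp add: algebra_simps)
  finally have "y * (1 - s\<^sup>2 / 2 - t * s / 2) = of_nat i * ((t + s) / 2) + of_nat j * ((t - s) / 2) + of_nat k"
    using pos by simp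
  then have eq: "t * (of_nat (i + j) + y * s) =
      y * (2 - s\<^sup>2) - (of_nat i - of_nat j) * s - 2 * of_nat k"
    by (simp add: field_simps)
  \<comment> \<open>The crucial point: \<open>i\<close> and \<open>j\<close> are natural numbers and
    \<open>y * s\<close> is positive, so the coefficient of \<open>t\<close> cannot vanish and the
    equation can be solved for \<open>t\<close>.\<close>
  have "of_nat (i + j) + y * s > 0"
    using y s by (intro add_nonneg_pos) auto
  then have "t = (y * (2 - s\<^sup>2) - (of_nat i - of_nat j) * s - 2 * of_nat k) / (of_nat (i + j) + y * s)"
    using eq by (simp add: field_simps)
  moreover have "\<dots> \<in> \<rat>"
    using \<open>y \<in> \<rat>\<close> \<open>s \<in> \<rat>\<close> by simp
  ultimately have "t \<in> \<rat>" by simp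
  then have "(t + s) / 2 \<in> \<rat>" "(t - s) / 2 \<in> \<rat>"
    using \<open>s \<in> \<rat>\<close> by simp_all
  moreover have "a / c = (t + s) / 2" "b / c = (t - s) / 2"
    using a b pos by simp_all
  ultimately show "a / c \<in> \<rat>" "b / c \<in> \<rat>"
    by metis+
qed

lemma triangle_with_angles_swap:
  assumes "triangle_with_angles A B C x y z"
  shows "triangle_with_angles B A C y x z" "triangle_with_angles C B A z y x"
  using assms
  by (auto simp: triangle_with_angles_def insert_commute
      vertex_angle_commute[of C B A] vertex_angle_commute[of B A C] vertex_angle_commute[of A C B])

theorem theorem5p3:
  fixes P Q R A B C :: plane and \<alpha> \<beta> :: real and \<T> :: "plane set set"
  assumes tile: "triangle_with_angles P Q R \<alpha> \<beta> (2 * pi / 3)"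
    and noncommensurable: "\<not> commensurable_angles \<alpha> \<beta> (2 * pi / 3)"
    and ABC: "triangle_with_angles A B C (2 * \<alpha>) (pi / 3) (2 * \<beta>)"
    and tiling: "tiling_by \<T> (triangle_region P Q R) (triangle_region A B C)"
  shows "commensurable_sides P Q R"
proof -
  define a b c where "a = dist Q R" and "b = dist R P" and "c = dist P Q"
  define Y where "Y = dist C A"
  note rel = tile_relations[OF tile, folded a_def b_def c_def]
  note big = big_triangle_sides[OF tile ABC, folded a_def b_def c_def Y_def]
  have "Y > 0"
    using triangle_with_angles_distinct[OF ABC] by (simp add: Y_def)
  have irr: "\<alpha> / pi \<notin> \<rat>"
  proof
    assume q: "\<alpha> / pi \<in> \<rat>"
    have "\<beta> = (1 / 3 - \<alpha> / pi) * pi" "\<alpha> = \<alpha> / pi * pi" "2 * pi / 3 = 2 / 3 * pi"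
      using rel(7) by (simp_all add: left_diff_distrib)
    moreover have "1 / 3 - \<alpha> / pi \<in> \<rat>" "2 / 3 \<in> (\<rat> :: real set)"
      using q by simp_all
    ultimately show False
      using noncommensurable q unfolding commensurable_angles_def by blast
  qed
  have irr': "\<beta> / pi \<notin> \<rat>"
  proof
    assume "\<beta> / pi \<in> \<rat>"
    moreover have "\<alpha> / pi = 1 / 3 - \<beta> / pi"
      using rel(7) by (simp add: field_simps)
    ultimately show False using irr by simp
  qed
  \<comment> \<open>By the law of cosines for the tile, the numerator
    \<open>4 * a * b + a\<^sup>2 + b\<^sup>2 - c\<^sup>2\<close> is
    \<open>3 * a * b\<close>.\<close>
  have excess: "dist A B + dist B C - dist C A = 3 * a * b * Y / c\<^sup>2"
  proof -
    have "dist A B + dist B C - dist C A =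
        Y * ((b\<^sup>2 + 2 * a * b) + (a\<^sup>2 + 2 * a * b) - c\<^sup>2) / c\<^sup>2"
      unfolding big Y_def[symmetric] using rel(3) by (simp add: field_simps)
    then show ?thesis
      unfolding rel(4) by (simp add: algebra_simps)
  qed
  obtain m where m: "3 * a * b * Y / c\<^sup>2 = of_int m * (c + a - b)"
    using integer_relation[OF tile irr rel(7) ABC tiling] excess
    by (auto simp: a_def b_def c_def)
  have swapped: "triangle_region Q P R = triangle_region P Q R" "triangle_region C B A = triangle_region A B C"
    by (simp_all add: triangle_region_def insert_commute)
  \<comment> \<open>Relabelling exchanges \<open>P\<close> with \<open>Q\<close> and
    \<open>A\<close> with \<open>C\<close>, hence \<alpha> with \<beta> and \<open>a\<close> with
    \<open>b\<close>; the regions and the excess stay the same.\<close>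
  obtain n where n: "3 * a * b * Y / c\<^sup>2 = of_int n * (c + b - a)"
    using integer_relation[OF triangle_with_angles_swap(1)[OF tile] irr' _
        triangle_with_angles_swap(2)[OF ABC], of \<T>] rel(7) tiling excess
    by (auto simp: a_def b_def c_def swapped dist_commute add.commute)
  obtain p q r where
    hull: "\<And>T. T \<in> \<T> \<Longrightarrow> T = convex hull {p T, q T, r T}"
    and sides: "\<And>T. T \<in> \<T> \<Longrightarrow> dist (q T) (r T) = a \<and> dist (r T) (p T) = b \<and> dist (p T) (q T) = c"
    using tiling_triangles[OF tile tiling] unfolding a_def b_def c_def by metis
  have side: "dist U V \<in> nat_combinations a b c"
    if "convex hull {U, V, W} = triangle_region A B C" "\<not> collinear {U, V, W}" for U V W
    using tiling that by (intro side_nat_combination[OF _ hull _ _ that(2) sides]) (auto simp: tiling_by_def)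
  have "\<not> collinear {A, B, C}"
    using ABC by (simp add: triangle_with_angles_def)
  then have Z: "Y * (b\<^sup>2 + 2 * a * b) / c\<^sup>2 \<in> nat_combinations a b c"
    and X: "Y * (a\<^sup>2 + 2 * a * b) / c\<^sup>2 \<in> nat_combinations a b c"
    using side[of A B C] side[of B C A] unfolding big
    by (simp_all add: triangle_region_def insert_commute)
  have "a \<noteq> b"
  proof
    assume "a = b"
    then have "cos \<alpha> = cos \<beta>" by (simp add: rel(5,6))
    then have "\<alpha> = \<beta>"
      using triangle_with_angles_bounds[OF tile] cos_inj_pi[of \<alpha> \<beta>] by simp
    then have "\<alpha> / pi = 1 / 6" using rel(7) by (simp add: field_simps)
    moreover have "1 / 6 \<in> (\<rat> :: real set)" by simp
    ultimately show False using irr by metis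
  qed
  then have "a / c \<in> \<rat> \<and> b / c \<in> \<rat>"
  proof (cases "b < a")
    case True
    then show ?thesis
      using rational_side_ratios[OF rel(2) _ rel(3) \<open>Y > 0\<close> rel(4) m n Z] by simp
  next
    case False
    \<comment> \<open>The mirror image of the first case: \<open>a\<close> and \<open>b\<close>
      change places, so do the two integer relations, and \<open>X\<close> for the side
      \<open>B C\<close> takes the place of \<open>Z\<close>.\<close>
    have rel': "c\<^sup>2 = b\<^sup>2 + b * a + a\<^sup>2"
      "3 * b * a * Y / c\<^sup>2 = of_int n * (c + b - a)" "3 * b * a * Y / c\<^sup>2 = of_int m * (c + a - b)"
      unfolding m[symmetric] n[symmetric] by (simp_all add: rel(4))
    have X': "Y * (a\<^sup>2 + 2 * b * a) / c\<^sup>2 \<in> nat_combinations b a c"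
      using X unfolding nat_combinations_def by (auto simp: ac_simps)
    have "a < b" using False \<open>a \<noteq> b\<close> by simp
    from rational_side_ratios[OF rel(1) this rel(3) \<open>Y > 0\<close> rel' X'] show ?thesis
      by (rule conjI[rotated])
  qed
  moreover have "s / t = (s / c) / (t / c)" for s t
    using rel(3) by simp
  moreover have "c / c = 1" using rel(3) by simp
  ultimately show ?thesis
    unfolding commensurable_sides_def a_def[symmetric] b_def[symmetric] c_def[symmetric]
    by (metis Rats_1 Rats_divide insertE singletonD)
qed

end
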